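(* Let $\alpha$ be an irrational real number with continued fraction expansion $\alpha=[a_0;a_1,a_2,\ldots]$ and sequence of best approximation denominators $(q_\ell)_{\ell\ge 0}$, and suppose that there is a constant $C$ such that for all integers $m'\ge 0$ $$\sum_{\ell=0}^{m'} \frac{a_{\ell+1}}{q_\ell^{1/2}}\sum_{k=1}^{\ell+1}a_k < C .$$ Let $\Gamma=\mathbb{Z}^2$, $G=\begin{pmatrix}1\\ \alpha\end{pmatrix}\mathbb{R}\subset\mathbb{R}^2$, $H=G^{\perp}$, and let $W=[a,b]\subset H$ be a compact interval with $a<b$. Let $\Lambda=\{\pi_1(x) : x\in\Gamma,\ \pi_2(x)\in W\}$ be the corresponding cut-and-project set, where $\pi_1,\pi_2$ are the orthogonal projections of $\mathbb{R}^2$ onto $G$ and $H$. Let $h\colon H\to\mathbb{R}$ be continuous on $H$ with support $W$, i.e. $h$ vanishes outside $W$ and $h(x)\neq 0$ for all $x$ in the interior of $W$. Suppose that at least one of the following holds: (1) $h$ is piecewise linear; or (2) $h$ is twice differentiable on $W$ and $h''$ is uniformly bounded on $W$. Then the weighted Dirac comb $\omega=\sum_{x\in\Lambda}h(x^\star)\,\delta_x$ is bounded distance equivalent to $m\lambda$, where $m=\int_a^b h(t)\,dt$.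
   Context: The lines $G$ and $H$ are identified isometrically with $\mathbb{R}$: $G$ via the unit vector $(1,\alpha)^T/\sqrt{1+\alpha^2}$ and $H$ via the unit vector $(-\alpha,1)^T/\sqrt{1+\alpha^2}$. Thus $W=[a,b]$ is an interval of real numbers, $h$ is a function of a real variable, and $\Lambda$ and $\omega$ live on $\mathbb{R}$. $\lambda$ is Lebesgue measure on $\mathbb{R}$, and $\delta_x$ is the Dirac measure at $x$. Since $\alpha$ is irrational, $\pi_1|_\Gamma$ is one-to-one, and for $x\in\Lambda$ one sets $x^\star:=\pi_2\big((\pi_1|_\Gamma)^{-1}(x)\big)$. The best approximation denominators $q_\ell$ of $\alpha$ are the denominators of the convergents $[a_0;a_1,\ldots,a_\ell]$ (so $q_0=1$, $q_1=a_1$, $q_{\ell+1}=a_{\ell+1}q_\ell+q_{\ell-1}$). Piecewise linear means piecewise affine with finitely many pieces. Two (possibly signed) measures $\mu,\nu$ on $\mathbb{R}$ are called bounded distance equivalent if there is $C'>0$ such that $|\mu([s,t])-\nu([s,t])|<C'$ for all $s,t\in\mathbb{R}$ with $s<t$. *)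

theory Defs
  imports "HOL-Probability.Probability"
begin

section \<open>Continued fractions\<close>

text \<open>The finite continued fraction \<open>[a\<^sub>0; a\<^sub>1, \<dots>, a\<^sub>n]\<close>, evaluated in the rationals.\<close>

primrec convergent_cf :: "(nat \<Rightarrow> int) \<Rightarrow> nat \<Rightarrow> rat" where
  "convergent_cf a 0 = of_int (a 0)"
| "convergent_cf a (Suc n) = of_int (a 0) + 1 / convergent_cf (\<lambda>k. a (Suc k)) n"

definition has_cf_expansion :: "real \<Rightarrow> (nat \<Rightarrow> int) \<Rightarrow> bool" where
  "has_cf_expansion \<alpha> a \<longleftrightarrow>
     (\<forall>k\<ge>1. a k \<ge> 1) \<and> (\<lambda>n. of_rat (convergent_cf a n)) \<longlonglongrightarrow> \<alpha>"

definition cf_denom :: "(nat \<Rightarrow> int) \<Rightarrow> nat \<Rightarrow> int" where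
  "cf_denom a n = snd (quotient_of (convergent_cf a n))"

text \<open>The usual recurrence for the denominators holds.  The proof goes through the
  continuants, which peel off the \<^emph>\<open>first\<close> partial quotient.\<close>

primrec cf_pair :: "(nat \<Rightarrow> int) \<Rightarrow> nat \<Rightarrow> int \<times> int" where
  "cf_pair a 0 = (a 0, 1)"
| "cf_pair a (Suc n) =
     (a 0 * fst (cf_pair (\<lambda>k. a (Suc k)) n) + snd (cf_pair (\<lambda>k. a (Suc k)) n),
      fst (cf_pair (\<lambda>k. a (Suc k)) n))"

lemma cf_pair_fst_pos: "(\<And>k. a k \<ge> 1) \<Longrightarrow> fst (cf_pair a n) \<ge> 1 \<and> snd (cf_pair a n) \<ge> 1"
proof (induction n arbitrary: a)
  case (Suc n)
  let ?p = "cf_pair (\<lambda>k. a (Suc k)) n"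
  have IH: "fst ?p \<ge> 1" "snd ?p \<ge> 1" using Suc.IH[of "\<lambda>k. a (Suc k)"] Suc.prems by auto
  have "a 0 * fst ?p \<ge> 0" using IH Suc.prems[of 0] by simp
  then show ?case using IH by simp
qed simp

lemma cf_pair_snd_pos:
  assumes "\<And>k. k \<ge> 1 \<Longrightarrow> a k \<ge> 1"
  shows "snd (cf_pair a n) \<ge> 1"
  using cf_pair_fst_pos[of "\<lambda>k. a (Suc k)"] assms by (cases n) auto

lemma convergent_cf_pair:
  assumes "\<And>k. k \<ge> 1 \<Longrightarrow> a k \<ge> 1"
  shows "convergent_cf a n = of_int (fst (cf_pair a n)) / of_int (snd (cf_pair a n))"
  using assms
proof (induction n arbitrary: a)
  case (Suc n)
  let ?p = "cf_pair (\<lambda>k. a (Suc k)) n"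
  have "fst ?p \<ge> 1" "snd ?p \<ge> 1"
    using cf_pair_fst_pos[of "\<lambda>k. a (Suc k)" n] Suc.prems by auto
  moreover have "convergent_cf (\<lambda>k. a (Suc k)) n = of_int (fst ?p) / of_int (snd ?p)"
    using Suc.IH[of "\<lambda>k. a (Suc k)"] Suc.prems by auto
  ultimately show ?case by (simp add: add_divide_distrib)
qed simp

lemma cf_pair_coprime: "coprime (fst (cf_pair a n)) (snd (cf_pair a n))"
proof (induction n arbitrary: a)
  case (Suc n)
  let ?p = "cf_pair (\<lambda>k. a (Suc k)) n"
  have "gcd (snd ?p + a 0 * fst ?p) (fst ?p) = gcd (snd ?p) (fst ?p)"
    by (metis gcd.commute gcd_add_mult add.commute)
  then show ?case using Suc.IH[of "\<lambda>k. a (Suc k)"]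
    by (simp add: coprime_iff_gcd_eq_1 gcd.commute add.commute)
qed simp

lemma cf_denom_eq_snd:
  assumes "\<And>k. k \<ge> 1 \<Longrightarrow> a k \<ge> 1"
  shows "cf_denom a n = snd (cf_pair a n)"
proof -
  have "convergent_cf a n = Fract (fst (cf_pair a n)) (snd (cf_pair a n))"
    using convergent_cf_pair[of a n] assms by (simp add: Fract_of_int_quotient)
  then show ?thesis
    using cf_pair_snd_pos[of a n] assms cf_pair_coprime[of a n]
    by (simp add: cf_denom_def quotient_of_Fract Rat.normalize_def coprime_iff_gcd_eq_1)
qed

lemma cf_pair_rec:
  "fst (cf_pair a (Suc (Suc n))) = a (Suc (Suc n)) * fst (cf_pair a (Suc n)) + fst (cf_pair a n) \<and>
   snd (cf_pair a (Suc (Suc n))) = a (Suc (Suc n)) * snd (cf_pair a (Suc n)) + snd (cf_pair a n)"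
proof (induction n arbitrary: a)
  case (Suc n)
  define b where "b = (\<lambda>k. a (Suc k))"
  have step: "cf_pair a (Suc m) = (a 0 * fst (cf_pair b m) + snd (cf_pair b m), fst (cf_pair b m))" for m
    by (simp add: b_def)
  have b: "b (Suc (Suc n)) = a (Suc (Suc (Suc n)))" by (simp add: b_def)
  show ?case
    unfolding step fst_conv snd_conv Suc.IH[of b, THEN conjunct1] Suc.IH[of b, THEN conjunct2] b
    by (simp add: algebra_simps)
qed (simp add: algebra_simps)

lemma cf_denom_rec:
  assumes "\<And>k. k \<ge> 1 \<Longrightarrow> a k \<ge> 1"
  shows "cf_denom a 0 = 1" "cf_denom a 1 = a 1"
    "cf_denom a (n + 2) = a (n + 2) * cf_denom a (n + 1) + cf_denom a n"
  using cf_pair_rec[of a n] assms by (simp_all add: cf_denom_eq_snd del: cf_pair.simps(2))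
    (simp_all add: cf_denom_eq_snd)


section \<open>The cut-and-project scheme\<close>

definition Gamma :: "(real^2) set" where
  "Gamma = {x. \<forall>i. x $ i \<in> \<int>}"

definition line_G :: "real \<Rightarrow> (real^2) set" where
  "line_G \<alpha> = range (\<lambda>t. t *\<^sub>R vector [1, \<alpha>])"

definition line_H :: "real \<Rightarrow> (real^2) set" where
  "line_H \<alpha> = orthogonal_comp (line_G \<alpha>)"

definition unit_G :: "real \<Rightarrow> real^2" where
  "unit_G \<alpha> = (1 / sqrt (1 + \<alpha>\<^sup>2)) *\<^sub>R vector [1, \<alpha>]"

definition unit_H :: "real \<Rightarrow> real^2" where
  "unit_H \<alpha> = (1 / sqrt (1 + \<alpha>\<^sup>2)) *\<^sub>R vector [- \<alpha>, 1]"

definition orth_proj :: "(real^2) set \<Rightarrow> real^2 \<Rightarrow> real^2" where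
  "orth_proj S x = (THE p. p \<in> S \<and> x - p \<in> orthogonal_comp S)"

text \<open>A point \<open>t *\<^sub>R unit_G \<alpha>\<close> of the line \<open>G\<close> is identified with its coordinate \<open>t\<close>, which is
  recovered by the inner product with \<open>unit_G \<alpha>\<close>; likewise for \<open>H\<close>.\<close>

definition pi1 :: "real \<Rightarrow> real^2 \<Rightarrow> real" where
  "pi1 \<alpha> x = orth_proj (line_G \<alpha>) x \<bullet> unit_G \<alpha>"

definition pi2 :: "real \<Rightarrow> real^2 \<Rightarrow> real" where
  "pi2 \<alpha> x = orth_proj (line_H \<alpha>) x \<bullet> unit_H \<alpha>"

definition cut_and_project :: "real \<Rightarrow> real set \<Rightarrow> real set" where
  "cut_and_project \<alpha> W = pi1 \<alpha> ` {x \<in> Gamma. pi2 \<alpha> x \<in> W}"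

definition star_map :: "real \<Rightarrow> real \<Rightarrow> real" where
  "star_map \<alpha> x = pi2 \<alpha> (the_inv_into Gamma (pi1 \<alpha>) x)"

lemma unit_G_H:
  "unit_G \<alpha> \<bullet> unit_G \<alpha> = 1" "unit_H \<alpha> \<bullet> unit_H \<alpha> = 1" "unit_G \<alpha> \<bullet> unit_H \<alpha> = 0"
proof -
  have "1 + \<alpha>\<^sup>2 > 0" by (simp add: add_pos_nonneg)
  then show "unit_G \<alpha> \<bullet> unit_G \<alpha> = 1" "unit_H \<alpha> \<bullet> unit_H \<alpha> = 1"
    by (simp_all add: unit_G_def unit_H_def inner_vec_def sum_2 field_simps flip: power2_eq_square)
  show "unit_G \<alpha> \<bullet> unit_H \<alpha> = 0"
    by (simp add: unit_G_def unit_H_def inner_vec_def sum_2)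
qed

lemma unit_decomp: "x = (x \<bullet> unit_G \<alpha>) *\<^sub>R unit_G \<alpha> + (x \<bullet> unit_H \<alpha>) *\<^sub>R unit_H \<alpha>"
proof -
  define r where "r = 1 / sqrt (1 + \<alpha>\<^sup>2)"
  have "1 + \<alpha>\<^sup>2 > 0" by (simp add: add_pos_nonneg)
  then have r: "r * r * (1 + \<alpha>\<^sup>2) = 1"
    by (simp add: r_def)
  have g: "unit_G \<alpha> $ 1 = r" "unit_G \<alpha> $ 2 = r * \<alpha>" "unit_H \<alpha> $ 1 = - r * \<alpha>" "unit_H \<alpha> $ 2 = r"
    by (simp_all add: unit_G_def unit_H_def r_def)
  have "(x $ 1 * r + x $ 2 * (r * \<alpha>)) * r + (x $ 1 * (- r * \<alpha>) + x $ 2 * r) * (- r * \<alpha>)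
      = x $ 1 * (r * r * (1 + \<alpha>\<^sup>2))"
    and "(x $ 1 * r + x $ 2 * (r * \<alpha>)) * (r * \<alpha>) + (x $ 1 * (- r * \<alpha>) + x $ 2 * r) * r
      = x $ 2 * (r * r * (1 + \<alpha>\<^sup>2))"
    by algebra+
  then show ?thesis
    by (simp add: vec_eq_iff forall_2 inner_vec_def sum_2 g r)
qed

lemma line_G_unit: "line_G \<alpha> = range (\<lambda>t. t *\<^sub>R unit_G \<alpha>)"
proof -
  have p: "sqrt (1 + \<alpha>\<^sup>2) > 0" by (simp add: add_pos_nonneg)
  have "t *\<^sub>R vector [1, \<alpha>] = (t * sqrt (1 + \<alpha>\<^sup>2)) *\<^sub>R unit_G \<alpha>" for t
    using p by (simp only: unit_G_def scaleR_scaleR) simp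
  moreover have "t *\<^sub>R unit_G \<alpha> = (t / sqrt (1 + \<alpha>\<^sup>2)) *\<^sub>R vector [1, \<alpha>]" for t
    by (simp add: unit_G_def)
  ultimately show ?thesis unfolding line_G_def by blast
qed

lemma line_H_unit: "line_H \<alpha> = range (\<lambda>t. t *\<^sub>R unit_H \<alpha>)"
proof -
  have "x \<in> line_H \<alpha> \<longleftrightarrow> x \<bullet> unit_G \<alpha> = 0" for x
    by (auto simp: line_H_def line_G_unit orthogonal_comp_def orthogonal_def inner_commute
        dest: spec[of _ 1])
  then show ?thesis
    using unit_decomp[of _ \<alpha>] unit_G_H(3)[of \<alpha>]
    by (auto simp: image_iff inner_commute) (metis add_0 scale_zero_left)
qed

lemma orthogonal_comp_line_H: "orthogonal_comp (line_H \<alpha>) = line_G \<alpha>"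
  unfolding line_H_def
  by (rule orthogonal_comp_self)
    (auto simp: line_G_def subspace_def image_iff simp flip: scaleR_add_left intro: exI[of _ 0])

lemma pi1_eq: "orth_proj (line_G \<alpha>) x = (x \<bullet> unit_G \<alpha>) *\<^sub>R unit_G \<alpha>" "pi1 \<alpha> x = x \<bullet> unit_G \<alpha>"
  and pi2_eq: "orth_proj (line_H \<alpha>) x = (x \<bullet> unit_H \<alpha>) *\<^sub>R unit_H \<alpha>" "pi2 \<alpha> x = x \<bullet> unit_H \<alpha>"
proof -
  have dG: "x - (x \<bullet> unit_G \<alpha>) *\<^sub>R unit_G \<alpha> = (x \<bullet> unit_H \<alpha>) *\<^sub>R unit_H \<alpha>"
    and dH: "x - (x \<bullet> unit_H \<alpha>) *\<^sub>R unit_H \<alpha> = (x \<bullet> unit_G \<alpha>) *\<^sub>R unit_G \<alpha>"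
    using unit_decomp[of x \<alpha>] by (simp_all add: algebra_simps)
  show G: "orth_proj (line_G \<alpha>) x = (x \<bullet> unit_G \<alpha>) *\<^sub>R unit_G \<alpha>"
    unfolding orth_proj_def line_H_def[symmetric]
  proof (rule the_equality)
    fix p assume "p \<in> line_G \<alpha> \<and> x - p \<in> line_H \<alpha>"
    then obtain s t where "p = s *\<^sub>R unit_G \<alpha>" "x - p = t *\<^sub>R unit_H \<alpha>"
      by (auto simp: line_G_unit line_H_unit)
    then have "x = s *\<^sub>R unit_G \<alpha> + t *\<^sub>R unit_H \<alpha>" by (simp add: algebra_simps)
    then have "x \<bullet> unit_G \<alpha> = s"
      by (simp add: inner_add_left unit_G_H unit_G_H(3)[of \<alpha>, unfolded inner_commute[of "unit_G \<alpha>"]])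
    then show "p = (x \<bullet> unit_G \<alpha>) *\<^sub>R unit_G \<alpha>"
      using \<open>p = _\<close> by simp
  qed (auto simp: dG line_G_unit line_H_unit)
  show H: "orth_proj (line_H \<alpha>) x = (x \<bullet> unit_H \<alpha>) *\<^sub>R unit_H \<alpha>"
    unfolding orth_proj_def orthogonal_comp_line_H
  proof (rule the_equality)
    fix p assume "p \<in> line_H \<alpha> \<and> x - p \<in> line_G \<alpha>"
    then obtain s t where "p = s *\<^sub>R unit_H \<alpha>" "x - p = t *\<^sub>R unit_G \<alpha>"
      by (auto simp: line_G_unit line_H_unit)
    then have "x = s *\<^sub>R unit_H \<alpha> + t *\<^sub>R unit_G \<alpha>" by (simp add: algebra_simps)
    then have "x \<bullet> unit_H \<alpha> = s"
      by (simp add: inner_add_left unit_G_H unit_G_H(3)[of \<alpha>, unfolded inner_commute[of "unit_G \<alpha>"]])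
    then show "p = (x \<bullet> unit_H \<alpha>) *\<^sub>R unit_H \<alpha>"
      using \<open>p = _\<close> by simp
  qed (auto simp: dH line_G_unit line_H_unit)
  show "pi1 \<alpha> x = x \<bullet> unit_G \<alpha>" "pi2 \<alpha> x = x \<bullet> unit_H \<alpha>"
    by (simp_all add: pi1_def pi2_def G H unit_G_H)
qed

lemma inj_on_pi1:
  assumes "\<alpha> \<notin> \<rat>"
  shows "inj_on (pi1 \<alpha>) Gamma"
proof (rule inj_onI)
  fix x y assume xy: "x \<in> Gamma" "y \<in> Gamma" "pi1 \<alpha> x = pi1 \<alpha> y"
  have "sqrt (1 + \<alpha>\<^sup>2) > 0" by (simp add: add_pos_nonneg)
  then have eq: "x $ 1 + \<alpha> * x $ 2 = y $ 1 + \<alpha> * y $ 2"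
    using xy(3) by (simp add: pi1_eq unit_G_def inner_vec_def sum_2 field_simps)
  have Q: "x $ i \<in> \<rat>" "y $ i \<in> \<rat>" for i
    using xy(1,2) Ints_subset_Rats by (auto simp: Gamma_def)
  have 2: "x $ 2 = y $ 2"
  proof (rule ccontr)
    assume "x $ 2 \<noteq> y $ 2"
    then have "\<alpha> = (y $ 1 - x $ 1) / (x $ 2 - y $ 2)"
      using eq by (simp add: field_simps)
    then show False using assms Q by (metis Rats_diff Rats_divide)
  qed
  with eq show "x = y" by (simp add: vec_eq_iff forall_2)
qed


section \<open>Weighted Dirac combs and bounded distance equivalence\<close>

text \<open>The signed measures at hand need not be finite, so they are represented by real-valued set
  functions, of which only the values on compact intervals matter.\<close>

definition weighted_dirac_comb :: "real set \<Rightarrow> (real \<Rightarrow> real) \<Rightarrow> real set \<Rightarrow> real" where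
  "weighted_dirac_comb \<Lambda> w A = (\<Sum>\<^sub>\<infinity>x\<in>\<Lambda>. w x * measure (return borel x) A)"

definition scaled_lebesgue :: "real \<Rightarrow> real set \<Rightarrow> real" where
  "scaled_lebesgue m A = m * measure lborel A"

definition bounded_distance_equivalent ::
    "(real set \<Rightarrow> real) \<Rightarrow> (real set \<Rightarrow> real) \<Rightarrow> bool" where
  "bounded_distance_equivalent \<mu> \<nu> \<longleftrightarrow>
     (\<exists>C'>0. \<forall>s t. s < t \<longrightarrow> \<bar>\<mu> {s..t} - \<nu> {s..t}\<bar> < C')"

text \<open>The infinite sum above is finite on compact intervals, because the point set is
  locally finite.\<close>

lemma finite_cut_and_project: "finite (cut_and_project \<alpha> {a..b} \<inter> {s..t})"
proof -
  define M where "M = \<bar>s\<bar> + \<bar>t\<bar> + \<bar>a\<bar> + \<bar>b\<bar>"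
  define F where "F = {x \<in> Gamma. norm x \<le> M}"
  define Z where "Z = {n :: real. n \<in> \<int> \<and> \<bar>n\<bar> \<le> M}"
  have "finite Z"
    unfolding Z_def by (rule finite_abs_int_segment)
  then have "finite ((\<lambda>(u, v). vector [u, v] :: real^2) ` (Z \<times> Z))"
    by blast
  moreover have "F \<subseteq> (\<lambda>(u, v). vector [u, v]) ` (Z \<times> Z)"
  proof
    fix x assume "x \<in> F"
    then have "x $ i \<in> Z" for i
      using component_le_norm_cart[of x i] by (auto simp: F_def Z_def Gamma_def)
    moreover have "x = vector [x $ 1, x $ 2]" by (simp add: vec_eq_iff forall_2)
    ultimately show "x \<in> (\<lambda>(u, v). vector [u, v]) ` (Z \<times> Z)"
      by (intro image_eqI[of _ _ "(x $ 1, x $ 2)"]) auto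
  qed
  ultimately have "finite F" by (rule rev_finite_subset)
  moreover have "cut_and_project \<alpha> {a..b} \<inter> {s..t} \<subseteq> pi1 \<alpha> ` F"
  proof
    fix y assume "y \<in> cut_and_project \<alpha> {a..b} \<inter> {s..t}"
    then obtain x where x: "x \<in> Gamma" "y = pi1 \<alpha> x" "pi2 \<alpha> x \<in> {a..b}" "pi1 \<alpha> x \<in> {s..t}"
      by (auto simp: cut_and_project_def)
    have "norm (unit_G \<alpha>) = 1" "norm (unit_H \<alpha>) = 1"
      using unit_G_H[of \<alpha>] by (simp_all add: norm_eq_sqrt_inner)
    then have "norm x \<le> \<bar>pi1 \<alpha> x\<bar> + \<bar>pi2 \<alpha> x\<bar>"
      using norm_triangle_ineq[of "(x \<bullet> unit_G \<alpha>) *\<^sub>R unit_G \<alpha>" "(x \<bullet> unit_H \<alpha>) *\<^sub>R unit_H \<alpha>"]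
        unit_decomp[of x \<alpha>] by (simp add: pi1_eq pi2_eq)
    also have "\<dots> \<le> M" using x(3,4) by (auto simp: M_def)
    finally show "y \<in> pi1 \<alpha> ` F" using x by (auto simp: F_def)
  qed
  ultimately show ?thesis by (meson finite_imageI finite_subset)
qed

lemma weighted_dirac_comb_Icc:
  "weighted_dirac_comb (cut_and_project \<alpha> {a..b}) w {s..t} =
     (\<Sum>x\<in>cut_and_project \<alpha> {a..b} \<inter> {s..t}. w x)"
proof -
  let ?L = "cut_and_project \<alpha> {a..b}"
  have "weighted_dirac_comb ?L w {s..t} = (\<Sum>\<^sub>\<infinity>x\<in>?L \<inter> {s..t}. w x)"
    unfolding weighted_dirac_comb_def
    by (rule infsum_cong_neutral) (auto simp: measure_return)
  then show ?thesis by (simp add: finite_cut_and_project)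
qed


section \<open>Piecewise linear functions\<close>

definition piecewise_linear :: "(real \<Rightarrow> real) \<Rightarrow> bool" where
  "piecewise_linear h \<longleftrightarrow>
     (\<exists>\<P>. finite \<P> \<and> \<Union>\<P> = UNIV \<and>
        (\<forall>I\<in>\<P>. is_interval I \<and> (\<exists>c d. \<forall>x\<in>I. h x = c * x + d)))"

text \<open>Derivatives are taken within \<open>W\<close>, hence one-sided at the end points of \<open>W\<close>.\<close>

definition bounded_second_derivative_on :: "(real \<Rightarrow> real) \<Rightarrow> real set \<Rightarrow> bool" where
  "bounded_second_derivative_on h W \<longleftrightarrow>
     (\<exists>h' h''.
        (\<forall>x\<in>W. (h has_real_derivative h' x) (at x within W)) \<and>
        (\<forall>x\<in>W. (h' has_real_derivative h'' x) (at x within W)) \<and>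
        bounded (h'' ` W))"

end

theory Submission
  imports Defs "HOL-Library.Periodic_Fun"
begin

text \<open>Put \<open>r = sqrt (1 + \<alpha>\<^sup>2)\<close>.  The lattice point \<open>(u, v)\<close> projects to \<open>(v - \<alpha> u) / r\<close> in \<open>H\<close> and, if this lies
  in the window, to \<open>r u + O(1)\<close> in \<open>G\<close>.  Up to boundedly many points the mass of \<open>[s, t]\<close> is therefore a
  Birkhoff sum over the rotation by \<open>\<alpha>\<close> of the periodic function \<open>F x = \<Sum>\<^sub>v h ((x + v) / r)\<close>, of
  mean \<open>r \<integral> h\<close>.

  The derivative of \<open>F\<close> has bounded variation, hence the increment \<open>F (x + \<tau>) - F x\<close> has variation
  \<open>O(\<bar>\<tau>\<bar>)\<close>.  By the Denjoy-Koksma inequality its Birkhoff sums of length \<open>q\<^sub>l\<close> are \<open>O(\<bar>\<tau>\<bar>)\<close>, and by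
  Ostrowski's numeration those of any length below \<open>q\<^sub>l\<close> are \<open>O(\<bar>\<tau>\<bar> (a\<^sub>1 + \<dots> + a\<^sub>l))\<close>.
  Let \<open>S\<close> be the Birkhoff sum of \<open>F\<close> of length \<open>q\<^sub>l\<close>.  Moving \<open>y\<close> by \<open>k \<alpha>\<close> with \<open>k < q\<^sub>l\<close> changes \<open>S y\<close>
  by a sum of \<open>k\<close> increments with \<open>\<bar>\<tau>\<bar> = \<bar>q\<^sub>l \<alpha> - p\<^sub>l\<bar> \<le> 1 / q\<^sub>l\<^sub>+\<^sub>1\<close>, and some \<open>y + k \<alpha>\<close> is within \<open>2 / q\<^sub>l\<close> of
  any given \<open>x\<close> modulo 1.  So \<open>S\<close> deviates from its mean by
  \<open>O(1 / q\<^sub>l + (a\<^sub>1 + \<dots> + a\<^sub>l) / q\<^sub>l\<^sub>+\<^sub>1)\<close>.  A second use of Ostrowski's numeration multiplies this by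
  \<open>a\<^sub>l\<^sub>+\<^sub>1\<close> and sums over \<open>l\<close>; the hypothesis on \<open>\<alpha>\<close> makes the sum finite.\<close>

section \<open>Convergents\<close>

lemma cf_pair_det:
  "fst (cf_pair a (Suc n)) * snd (cf_pair a n) - fst (cf_pair a n) * snd (cf_pair a (Suc n)) = (- 1) ^ n"
proof (induction n)
  case (Suc n)
  then show ?case
    using cf_pair_rec[of a n] by (simp add: algebra_simps del: cf_pair.simps(2))
qed (simp add: algebra_simps)

text \<open>For fixed \<open>n\<close> the whole expression obeys the continuant recurrence in
  \<open>m\<close>, with nonnegative coefficients and starting values 0 and 1. It fixes the side of
  the \<open>n\<close>-th convergent on which all later ones lie.\<close>

lemma cf_pair_sgn:
  assumes "\<And>k. k \<ge> 1 \<Longrightarrow> a k \<ge> 1"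
  shows "(- 1) ^ n * (fst (cf_pair a (n + m)) * snd (cf_pair a n) - fst (cf_pair a n) * snd (cf_pair a (n + m))) \<ge> 0"
    (is "?e m \<ge> 0")
proof (induction m rule: induct_nat_012)
  case 1
  show ?case using cf_pair_det[of a n]
    by (simp add: algebra_simps flip: power_add del: cf_pair.simps(2))
next
  case (ge2 m)
  have "?e (Suc (Suc m)) = a (n + Suc (Suc m)) * ?e (Suc m) + ?e m"
    using cf_pair_rec[of a "n + m"] by (simp add: algebra_simps del: cf_pair.simps(2))
  also have "\<dots> \<ge> 0"
    using ge2 assms[of "n + Suc (Suc m)"]
    by (intro add_nonneg_nonneg mult_nonneg_nonneg[of "a k" for k]) (simp_all del: cf_pair.simps(2) add_Suc_right)
  finally show ?case .
qed simp

text \<open>The errors of consecutive convergents have opposite signs, so the determinant identity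
  writes 1 as a sum of two nonnegative terms, one of which is \<open>q (Suc n) * e\<close>.\<close>

lemma cf_pair_approx:
  fixes \<alpha> :: real
  assumes "has_cf_expansion \<alpha> a"
  shows "\<bar>\<alpha> * snd (cf_pair a n) - fst (cf_pair a n)\<bar> \<le> 1 / snd (cf_pair a (Suc n))"
proof -
  have pos: "a k \<ge> 1" if "k \<ge> 1" for k
    using assms that by (simp add: has_cf_expansion_def)
  define p q where "p n = real_of_int (fst (cf_pair a n))"
    and "q n = real_of_int (snd (cf_pair a n))" for n
  have q1: "q n \<ge> 1" for n
    using cf_pair_snd_pos[of a n] pos by (simp add: q_def)
  have q: "q n > 0" for n using q1[of n] by simp
  have lim: "(\<lambda>n. p n / q n) \<longlonglongrightarrow> \<alpha>"
    using assms convergent_cf_pair[of a] pos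
    by (simp add: has_cf_expansion_def p_def q_def of_rat_divide)
  \<comment> \<open>The sign given by \<open>cf_pair_sgn\<close> survives the limit in
    \<open>m\<close>.\<close>
  have sgn: "(- 1) ^ n * (\<alpha> * q n - p n) \<ge> 0" for n
  proof -
    have nonneg: "(- 1) ^ n * (p (n + m) / q (n + m) * q n - p n) \<ge> 0" for m
    proof -
      have "(- 1) ^ n * (p (n + m) * q n - p n * q (n + m)) \<ge> 0"
        using cf_pair_sgn[of a n m, OF pos, THEN of_int_0_le_iff[where 'a = real, THEN iffD2]]
        by (simp add: p_def q_def)
      moreover have "(- 1) ^ n * (p (n + m) / q (n + m) * q n - p n)
        = (- 1) ^ n * (p (n + m) * q n - p n * q (n + m)) / q (n + m)"
        using q[of "n+m"] by (simp add: field_simps)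
      ultimately show ?thesis using q[of "n+m"] by (simp add: divide_nonneg_pos)
    qed
    have "(\<lambda>m. p (n + m) / q (n + m)) \<longlonglongrightarrow> \<alpha>"
      unfolding add.commute[of n] using LIMSEQ_ignore_initial_segment[OF lim, of n] .
    then have "(\<lambda>m. (- 1) ^ n * (p (n + m) / q (n + m) * q n - p n)) \<longlonglongrightarrow> (- 1) ^ n * (\<alpha> * q n - p n)"
      by (intro tendsto_intros)
    then show ?thesis by (rule LIMSEQ_le_const) (use nonneg in blast)
  qed
  have det: "p (Suc n) * q n - p n * q (Suc n) = (- 1) ^ n"
    using cf_pair_det[of a n] unfolding p_def q_def
    by (simp only: of_int_mult[symmetric] of_int_diff[symmetric]) simp
  define e f where "e = (- 1) ^ n * (\<alpha> * q n - p n)"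
    and "f = (- 1) ^ Suc n * (\<alpha> * q (Suc n) - p (Suc n))"
  have "q (Suc n) * e + q n * f = (- 1) ^ n * (p (Suc n) * q n - p n * q (Suc n))"
    by (simp add: e_def f_def algebra_simps)
  also have "\<dots> = 1" by (simp add: det flip: power_add)
  finally have "q (Suc n) * e + q n * f = 1" .
  moreover have "f \<ge> 0" "e \<ge> 0"
    using sgn[of n] sgn[of "Suc n"] by (auto simp only: e_def f_def)
  then have "q n * f \<ge> 0" "e \<ge> 0" using q[of n] by auto
  ultimately have "q (Suc n) * e \<le> 1" by linarith
  then have "e \<le> 1 / q (Suc n)" using q[of "Suc n"] by (simp add: field_simps)
  moreover have "\<bar>\<alpha> * q n - p n\<bar> = e"
    using \<open>e \<ge> 0\<close> by (cases "even n") (simp_all add: e_def)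
  ultimately show ?thesis by (simp add: p_def q_def)
qed

text \<open>The upper bound will limit the Ostrowski digits; the linear growth makes the
  denominators exceed any given length.\<close>

lemma cf_denom_mono:
  assumes "\<And>k. k \<ge> 1 \<Longrightarrow> a k \<ge> 1"
  shows "cf_denom a n \<ge> 1" "cf_denom a n \<le> cf_denom a (Suc n)"
    "cf_denom a (Suc n) \<ge> a (Suc n) * cf_denom a n"
    "cf_denom a (Suc n) \<le> (a (Suc n) + 1) * cf_denom a n"  "cf_denom a (Suc n) \<ge> int n"
proof -
  have p: "cf_denom a n \<ge> 1" for n
    using cf_denom_eq_snd[of a n] cf_pair_snd_pos[of a n] assms by simp
  show "cf_denom a n \<ge> 1" by (rule p)
  have ge: "cf_denom a (Suc n) \<ge> a (Suc n) * cf_denom a n" for n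
    using p[of "n-1"] cf_denom_rec(1,2)[of a] cf_denom_rec(3)[of a "n-1"] assms by (cases n) simp_all
  show "cf_denom a (Suc n) \<ge> a (Suc n) * cf_denom a n" by (rule ge)
  have mono: "cf_denom a n \<le> cf_denom a (Suc n)" for n
    using ge[of n] mult_right_mono[of 1 "a (Suc n)" "cf_denom a n"] assms[of "Suc n"] p[of n] by linarith
  show "cf_denom a n \<le> cf_denom a (Suc n)" by (rule mono)
  show "cf_denom a (Suc n) \<le> (a (Suc n) + 1) * cf_denom a n"
    using p[of "n-1"] mono[of "n - 1"] cf_denom_rec(1,2)[of a] cf_denom_rec(3)[of a "n-1"] assms
    by (cases n) (simp_all add: algebra_simps)
  show "cf_denom a (Suc n) \<ge> int n"
  proof (induction n)
    case (Suc n)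
    have "cf_denom a (Suc (Suc n)) = a (Suc (Suc n)) * cf_denom a (Suc n) + cf_denom a n"
      using cf_denom_rec(3)[of a n] assms by simp
    moreover have "a (Suc (Suc n)) * cf_denom a (Suc n) \<ge> 1 * cf_denom a (Suc n)"
      using assms p[of "Suc n"] by (intro mult_right_mono) auto
    ultimately show ?case using p[of n] Suc by simp
  qed (use p[of 1] in auto)
qed

section \<open>Birkhoff sums of a rotation\<close>

text \<open>For \<open>F = \<integral>g\<close> with \<open>g\<close> of bounded variation, the increment \<open>x \<mapsto> F (x + \<tau>) - F x\<close> has variation
  at most a multiple of \<open>\<bar>\<tau>\<bar>\<close>.  Only this consequence is recorded here, for the partitions of an
  interval of length \<open>1\<close> into \<open>q\<close> equal parts; no derivative of \<open>F\<close> needs to exist.\<close>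

definition osc_diff :: "real \<Rightarrow> (real \<Rightarrow> real) \<Rightarrow> bool" where
  "osc_diff K F \<longleftrightarrow> (\<forall>\<tau> x y z q. q > 0 \<longrightarrow>
     (\<forall>j<q. y j \<in> {x + real j / real q..x + real (Suc j) / real q}) \<longrightarrow>
     (\<forall>j<q. z j \<in> {x + real j / real q..x + real (Suc j) / real q}) \<longrightarrow>
     (\<Sum>j<q. \<bar>(F (y j + \<tau>) - F (y j)) - (F (z j + \<tau>) - F (z j))\<bar>) \<le> K * \<bar>\<tau>\<bar>)"

lemma osc_diffD:
  assumes "osc_diff K F" "q > 0"
    "\<And>j. j < q \<Longrightarrow> y j \<in> {x + real j / real q..x + real (Suc j) / real q}"
    "\<And>j. j < q \<Longrightarrow> z j \<in> {x + real j / real q..x + real (Suc j) / real q}"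
  shows "\<bar>(\<Sum>j<q. F (y j + \<tau>) - F (y j)) - (\<Sum>j<q. F (z j + \<tau>) - F (z j))\<bar> \<le> K * \<bar>\<tau>\<bar>"
proof -
  have "\<bar>(\<Sum>j<q. F (y j + \<tau>) - F (y j)) - (\<Sum>j<q. F (z j + \<tau>) - F (z j))\<bar>
    \<le> (\<Sum>j<q. \<bar>(F (y j + \<tau>) - F (y j)) - (F (z j + \<tau>) - F (z j))\<bar>)"
    unfolding sum_subtractf[symmetric] by (rule sum_abs)
  also have "\<dots> \<le> K * \<bar>\<tau>\<bar>"
    using assms unfolding osc_diff_def by blast
  finally show ?thesis .
qed

lemma osc_diff_minus: "osc_diff K F \<Longrightarrow> osc_diff K (\<lambda>x. - F x)"
  unfolding osc_diff_def by (simp add: abs_minus_commute algebra_simps)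

lemma osc_diff_nonneg:
  assumes "osc_diff K F" shows "K \<ge> 0"
  using osc_diffD[OF assms, where x = 0 and q = 1 and y = "\<lambda>_. 0" and z = "\<lambda>_. 0" and \<tau> = 1] by simp

lemma periodic_attains_max:
  fixes f :: "real \<Rightarrow> real"
  assumes "continuous_on UNIV f" "\<And>x. f (x + d) = f x" "d > 0"
  shows "\<exists>x0\<in>{x..x + d}. \<forall>y. f y \<le> f x0"
proof -
  interpret periodic_fun_simple f d by standard (rule assms)
  obtain x0 where x0: "x0 \<in> {x..x+d}" "\<And>y. y \<in> {x..x+d} \<Longrightarrow> f y \<le> f x0"
    using continuous_attains_sup[of "{x..x+d}" f] assms continuous_on_subset by force
  have "f y \<le> f x0" for y
  proof -
    define n where "n = \<lfloor>(y - x) / d\<rfloor>"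
    have "of_int n \<le> (y - x) / d" "(y - x) / d < of_int n + 1" by (auto simp: n_def)
    then have "y - of_int n * d \<in> {x..x+d}" using \<open>d > 0\<close> by (auto simp: field_simps)
    from x0(2)[OF this] show ?thesis by (simp add: minus_of_int)
  qed
  with x0(1) show ?thesis by blast
qed

definition birkhoff :: "(real \<Rightarrow> real) \<Rightarrow> real \<Rightarrow> nat \<Rightarrow> real \<Rightarrow> real" where
  "birkhoff F \<alpha> N x = (\<Sum>u<N. F (x + real u * \<alpha>))"

lemma birkhoff_add: "birkhoff F \<alpha> (M + N) x = birkhoff F \<alpha> M x + birkhoff F \<alpha> N (x + real M * \<alpha>)"
proof (induction N)
  case (Suc N)
  then show ?case by (simp add: birkhoff_def algebra_simps)
qed (simp add: birkhoff_def)

lemma birkhoff_mult_le: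
  assumes "\<And>x. \<bar>birkhoff F \<alpha> q x - real q * m\<bar> \<le> e"
  shows "\<bar>birkhoff F \<alpha> (b * q) x - real (b * q) * m\<bar> \<le> real b * e"
proof (induction b arbitrary: x)
  case (Suc b)
  have "birkhoff F \<alpha> (Suc b * q) x - real (Suc b * q) * m =
    (birkhoff F \<alpha> q x - real q * m) + (birkhoff F \<alpha> (b * q) (x + real q * \<alpha>) - real (b * q) * m)"
    by (simp add: birkhoff_add algebra_simps)
  also have "\<bar>\<dots>\<bar> \<le> e + real b * e"
    using assms[of x] Suc[of "x + real q * \<alpha>"] by linarith
  finally show ?case by (simp add: algebra_simps)
qed (simp add: birkhoff_def)

text \<open>Ostrowski's numeration: \<open>N\<close> is split greedily into blocks whose lengths are the \<open>q\<^sub>i\<close>.\<close>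

lemma ostrowski_bound:
  assumes "q 0 = 1" and "\<And>i. q i \<ge> 1" and "\<And>i. q (Suc i) \<le> (A (Suc i) + 1) * q i"
    and e: "\<And>i x. \<bar>birkhoff F \<alpha> (q i) x - real (q i) * m\<bar> \<le> e i"
    and "N < q l"
  shows "\<bar>birkhoff F \<alpha> N x - real N * m\<bar> \<le> (\<Sum>i<l. real (A (Suc i)) * e i)"
  using \<open>N < q l\<close>
proof (induction l arbitrary: N x)
  case (Suc l)
  define b r where "b = N div q l" and "r = N mod q l"
  have N: "N = b * q l + r" by (simp add: b_def r_def)
  have "r < q l" using assms(2)[of l] by (simp add: r_def)
  \<comment> \<open>The greedy digit \<open>b\<close> is at most \<open>A (Suc l)\<close> because
    \<open>N\<close> lies below \<open>q (Suc l)\<close>.\<close>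
  have "b * q l < (A (Suc l) + 1) * q l"
    using Suc.prems assms(3)[of l] N by linarith
  then have "b < A (Suc l) + 1" using mult_less_cancel2 by blast
  then have "b \<le> A (Suc l)" by simp
  have "e l \<ge> 0" using e[of l x] by linarith
  have "birkhoff F \<alpha> N x - real N * m = (birkhoff F \<alpha> (b * q l) x - real (b * q l) * m)
     + (birkhoff F \<alpha> r (x + real (b * q l) * \<alpha>) - real r * m)"
    unfolding N birkhoff_add by (simp add: algebra_simps)
  also have "\<bar>\<dots>\<bar> \<le> real b * e l + (\<Sum>i<l. real (A (Suc i)) * e i)"
    using birkhoff_mult_le[OF e, of b l x] Suc.IH[OF \<open>r < q l\<close>, of "x + real (b * q l) * \<alpha>"] by linarith
  also have "\<dots> \<le> real (A (Suc l)) * e l + (\<Sum>i<l. real (A (Suc i)) * e i)"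
    using \<open>b \<le> A (Suc l)\<close> \<open>e l \<ge> 0\<close> by (simp add: mult_right_mono)
  finally show ?case by simp
qed (use assms(1) in \<open>simp add: birkhoff_def\<close>)

section \<open>Rational approximation of the rotation and the Denjoy-Koksma inequality\<close>

lemma bij_betw_mult_mod:
  fixes p :: int
  assumes "coprime p (int q)" "q > 0"
  shows "bij_betw (\<lambda>u. nat (int u * p mod int q)) {..<q} {..<q}"
proof -
  have "inj_on (\<lambda>u. nat (int u * p mod int q)) {..<q}"
  proof (rule inj_onI)
    fix u v assume uv: "u \<in> {..<q}" "v \<in> {..<q}"
      "nat (int u * p mod int q) = nat (int v * p mod int q)"
    then have "int u * p mod int q = int v * p mod int q"
      using assms by (simp add: nat_eq_iff2)
    then have "int q dvd (int u - int v) * p"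
      by (simp add: mod_eq_dvd_iff left_diff_distrib)
    then have "int q dvd int u - int v"
      using assms(1) by (simp add: coprime_dvd_mult_left_iff coprime_commute)
    then have "int u mod int q = int v mod int q" by (simp add: mod_eq_dvd_iff)
    then show "u = v" using uv by simp
  qed
  moreover have "(\<lambda>u. nat (int u * p mod int q)) ` {..<q} \<subseteq> {..<q}"
    using assms(2) by (auto simp: nat_less_iff)
  ultimately show ?thesis
    by (simp add: bij_betw_def endo_inj_surj)
qed

text \<open>Modulo 1 the orbit point is a point of the grid of mesh \<open>1/q\<close>, displaced by
  \<open>u\<close> times the approximation error; periodic functions do not see the integer
  term.\<close>

lemma mult_rotation_decomp:
  fixes p :: int and \<alpha> :: real
  assumes "q > 0"
  shows "real u * \<alpha> = real (nat (int u * p mod int q)) / real q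
       + real u * (\<alpha> - real_of_int p / real q) + real_of_int (int u * p div int q)"
proof -
  have "int u * p = int q * (int u * p div int q) + int u * p mod int q" by simp
  then have "real_of_int (int u * p) = real_of_int (int q * (int u * p div int q) + int u * p mod int q)"
    by (simp only:)
  then have "real u * real_of_int p = real q * real_of_int (int u * p div int q) + real_of_int (int u * p mod int q)"
    by (simp only: of_int_add of_int_mult of_int_of_nat_eq)
  moreover have "real (nat (int u * p mod int q)) = real_of_int (int u * p mod int q)"
    using assms by simp
  ultimately show ?thesis using assms by (simp add: field_simps)
qed

text \<open>The sum of \<open>F\<close> over a grid of mesh \<open>1/q\<close> is \<open>1/q\<close>-periodic in the offset, so it has a maximum
  within \<open>1/q\<close> of \<open>x\<close>, and there its increments are nonpositive.\<close>

lemma grid_sum_le: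
  assumes F: "osc_diff K F" "continuous_on UNIV F" "\<And>x. F (x + 1) = F x" and "q > 0"
  shows "(\<Sum>j<q. F (x + real j / real q + \<tau>) - F (x + real j / real q)) \<le> K * \<bar>\<tau>\<bar>"
proof -
  define T where "T x = (\<Sum>j<q. F (x + real j / real q))" for x
  have "T (x + 1 / real q) = T x" for x
  proof -
    \<comment> \<open>Shifting by one mesh permutes the grid cyclically; the term leaving at the end
      is \<open>F (x + 1)\<close>, which equals the missing first term.\<close>
    have "T (x + 1 / real q) = (\<Sum>j<q. F (x + real (Suc j) / real q))"
      by (simp add: T_def add_divide_distrib add_ac)
    also have "\<dots> = (\<Sum>j<Suc q. F (x + real j / real q)) - F x"
      by (simp add: sum.lessThan_Suc_shift del: sum.lessThan_Suc)
    also have "\<dots> = T x" using \<open>q > 0\<close> F(3)[of x] by (simp add: T_def)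
    finally show ?thesis .
  qed
  moreover have "continuous_on UNIV T"
    unfolding T_def by (intro continuous_intros continuous_on_compose2[OF F(2)]) auto
  ultimately obtain x0 where x0: "x0 \<in> {x..x + 1 / real q}" "\<And>y. T y \<le> T x0"
    using periodic_attains_max[of T "1 / real q" x] \<open>q > 0\<close> by auto
  \<comment> \<open>The points \<open>x0 + j/q\<close> and \<open>x + j/q\<close> share a cell, so
    moving the base point to the maximum costs one oscillation.\<close>
  have "\<bar>(\<Sum>j<q. F (x + real j / real q + \<tau>) - F (x + real j / real q)) -
    (\<Sum>j<q. F (x0 + real j / real q + \<tau>) - F (x0 + real j / real q))\<bar> \<le> K * \<bar>\<tau>\<bar>"
    by (rule osc_diffD[OF F(1) \<open>q > 0\<close>, where x = x]) (use x0 in \<open>auto simp: add_divide_distrib\<close>)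
  moreover have "(\<Sum>j<q. F (x0 + real j / real q + \<tau>) - F (x0 + real j / real q)) = T (x0 + \<tau>) - T x0"
    by (simp add: T_def sum_subtractf add_ac)
  ultimately show ?thesis using x0(2)[of "x0 + \<tau>"] by linarith
qed

text \<open>This is the inequality for the increment of \<open>F\<close> by \<open>\<tau>\<close>,
  whose mean is 0. Reordered, the orbit is a grid displaced by at most \<open>1/q\<close>: replacing
  it by the grid costs \<open>K * \<bar>\<tau>\<bar>\<close>, and \<open>grid_sum_le\<close> bounds
  the grid sum by the same amount.\<close>

lemma denjoy_koksma:
  assumes F: "osc_diff K F" "continuous_on UNIV F" "\<And>x. F (x + 1) = F x"
    and q: "q > 0" "coprime p (int q)" "\<bar>\<alpha> - real_of_int p / real q\<bar> \<le> 1 / (real q)\<^sup>2"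
  shows "\<bar>birkhoff F \<alpha> q (x + \<tau>) - birkhoff F \<alpha> q x\<bar> \<le> 2 * K * \<bar>\<tau>\<bar>"
proof -
  interpret periodic_fun_simple' F by standard (rule F)
  define \<delta> where "\<delta> = \<alpha> - real_of_int p / real q"
  define G where "G x = F (x + \<tau>) - F x" for x
  define \<sigma> where "\<sigma> = (\<lambda>u. nat (int u * p mod int q))"
  have bij: "bij_betw \<sigma> {..<q} {..<q}"
    unfolding \<sigma>_def using bij_betw_mult_mod[OF q(2,1)] .
  define \<rho> where "\<rho> = inv_into {..<q} \<sigma>"
  have bij': "bij_betw \<rho> {..<q} {..<q}"
    unfolding \<rho>_def by (rule bij_betw_inv_into[OF bij])
  have \<sigma>\<rho>: "\<sigma> (\<rho> j) = j" "\<rho> j < q" if "j < q" for j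
    using bij_betw_inv_into_right[OF bij] bij_betw_apply[OF bij'] that by (auto simp: \<rho>_def)
  have u\<delta>: "\<bar>real u * \<delta>\<bar> \<le> 1 / real q" if "u < q" for u
  proof -
    have "\<bar>real u * \<delta>\<bar> \<le> real q * (1 / (real q)\<^sup>2)"
      unfolding abs_mult using that q(3) by (intro mult_mono) (auto simp: \<delta>_def)
    then show ?thesis using q(1) by (simp add: power2_eq_square)
  qed
  define y where "y j = x + real j / real q + real (\<rho> j) * \<delta>" for j
  have "F (x + real (\<rho> j) * \<alpha>) = F (y j)" "F (x + \<tau> + real (\<rho> j) * \<alpha>) = F (y j + \<tau>)" if "j < q" for j
  proof -
    have "nat (int (\<rho> j) * p mod int q) = j" using \<sigma>\<rho>[OF that] by (simp add: \<sigma>_def)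
    then have *: "real (\<rho> j) * \<alpha> = real j / real q + real (\<rho> j) * \<delta> + of_int (int (\<rho> j) * p div int q)"
      using mult_rotation_decomp[OF q(1), of "\<rho> j" \<alpha> p] by (simp only: \<delta>_def)
    have "x + real (\<rho> j) * \<alpha> = y j + of_int (int (\<rho> j) * p div int q)"
     "x + \<tau> + real (\<rho> j) * \<alpha> = y j + \<tau> + of_int (int (\<rho> j) * p div int q)"
      unfolding * y_def by simp_all
    then show "F (x + real (\<rho> j) * \<alpha>) = F (y j)" "F (x + \<tau> + real (\<rho> j) * \<alpha>) = F (y j + \<tau>)"
      by (simp_all only: plus_of_int)
  qed
  then have eq: "birkhoff F \<alpha> q (x + \<tau>) - birkhoff F \<alpha> q x = (\<Sum>j<q. F (y j + \<tau>) - F (y j))"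
    unfolding birkhoff_def sum_subtractf[symmetric]
    by (subst sum.reindex_bij_betw[OF bij', symmetric]) simp
  \<comment> \<open>All displacements have the sign of \<open>\<delta>\<close>. Starting the
    partition at \<open>x\<close>, or one mesh earlier for negative \<open>\<delta>\<close>, puts
    \<open>y j\<close> and its grid point into the same cell.\<close>
  define x1 where "x1 = (if \<delta> \<ge> 0 then x else x - 1 / real q)"
  have "\<bar>(\<Sum>j<q. F (y j + \<tau>) - F (y j)) -
    (\<Sum>j<q. F (x + real j / real q + \<tau>) - F (x + real j / real q))\<bar> \<le> K * \<bar>\<tau>\<bar>"
  proof (rule osc_diffD[OF F(1) q(1), where x = x1])
    fix j assume "j < q"
    have "real (\<rho> j) * \<delta> \<ge> 0" if "\<delta> \<ge> 0" using that by simp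
    moreover have "real (\<rho> j) * \<delta> \<le> 0" if "\<not> \<delta> \<ge> 0" using that by (simp add: mult_nonneg_nonpos)
    ultimately show "y j \<in> {x1 + real j / real q..x1 + real (Suc j) / real q}"
      using u\<delta>[OF \<sigma>\<rho>(2)[OF \<open>j < q\<close>]] by (auto simp: x1_def y_def add_divide_distrib abs_le_iff)
    show "x + real j / real q \<in> {x1 + real j / real q..x1 + real (Suc j) / real q}"
      by (auto simp: x1_def add_divide_distrib)
  qed
  moreover have "(\<Sum>j<q. F (x + real j / real q + \<tau>) - F (x + real j / real q)) \<le> K * \<bar>\<tau>\<bar>"
    by (rule grid_sum_le) (use F q in auto)
  \<comment> \<open>The lower bound is the upper bound for \<open>- F\<close>.\<close>
  moreover have "(\<Sum>j<q. - F (x + real j / real q + \<tau>) - - F (x + real j / real q)) \<le> K * \<bar>\<tau>\<bar>"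
    by (rule grid_sum_le) (use F q osc_diff_minus in \<open>auto intro: continuous_intros\<close>)
  then have "- (\<Sum>j<q. F (x + real j / real q + \<tau>) - F (x + real j / real q)) \<le> K * \<bar>\<tau>\<bar>"
    unfolding sum_negf[symmetric] by (simp add: algebra_simps)
  ultimately show ?thesis unfolding eq by (simp add: abs_le_iff)
qed

text \<open>Choose the grid point just below the fractional part of \<open>d\<close> and the
  \<open>k\<close> whose multiple of \<open>p\<close> has that residue. The grid and the
  displacement of the orbit each contribute an error of at most \<open>1/q\<close>.\<close>

lemma rotation_dense:
  assumes q: "q > 0" "coprime p (int q)" "\<bar>\<alpha> - real_of_int p / real q\<bar> \<le> 1 / (real q)\<^sup>2"
  shows "\<exists>k<q. \<exists>n::int. \<bar>d - real k * \<alpha> - real_of_int n\<bar> \<le> 2 / real q"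
proof -
  define \<delta> where "\<delta> = \<alpha> - real_of_int p / real q"
  define j where "j = nat \<lfloor>frac d * real q\<rfloor>"
  have fl: "real j = of_int \<lfloor>frac d * real q\<rfloor>" by (simp add: j_def)
  have "frac d * real q < real q" using q(1) frac_lt_1[of d] by simp
  then have "j < q" using fl by linarith
  then have "j \<in> (\<lambda>u. nat (int u * p mod int q)) ` {..<q}"
    using bij_betw_imp_surj_on[OF bij_betw_mult_mod[OF q(2,1)]] by simp
  then obtain k where k: "k < q" "nat (int k * p mod int q) = j"
    by (auto simp only: image_iff lessThan_iff)
  have "\<bar>real k * \<delta>\<bar> \<le> real q * (1 / (real q)\<^sup>2)"
    unfolding abs_mult using k(1) q(3) by (intro mult_mono) (auto simp: \<delta>_def)
  then have k\<delta>: "\<bar>real k * \<delta>\<bar> \<le> 1 / real q" using q(1) by (simp add: power2_eq_square)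
  have "real j \<le> frac d * real q" "frac d * real q \<le> real j + 1" using fl by linarith+
  then have "real j / real q \<le> frac d" "frac d \<le> real j / real q + 1 / real q"
    using q(1) by (simp_all add: field_simps)
  then have "\<bar>frac d - real j / real q - real k * \<delta>\<bar> \<le> 2 / real q"
    using k\<delta> by (simp add: abs_le_iff)
  moreover have "d - real k * \<alpha> - real_of_int (\<lfloor>d\<rfloor> - int k * p div int q) = frac d - real j / real q - real k * \<delta>"
    using mult_rotation_decomp[OF q(1), of k \<alpha> p] unfolding k(2) by (simp add: frac_def \<delta>_def)
  ultimately show ?thesis using k(1) by metis
qed

section \<open>From block sums to uniformly bounded deviations\<close>

lemma birkhoff_periodic:
  assumes "\<And>x. F (x + 1) = F x"
  shows "birkhoff F \<alpha> N (x + of_int n) = birkhoff F \<alpha> N x"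
proof -
  interpret periodic_fun_simple' F by standard (rule assms)
  have "F (x + of_int n + y) = F (x + y)" for y
    using plus_of_int[of "x + y" n] by (simp add: add_ac)
  then show ?thesis by (simp add: birkhoff_def)
qed

text \<open>Both sides come from splitting the sum of length \<open>q + k\<close> in its two ways.
  Moving a long sum by \<open>k\<close> rotations thus becomes moving a short sum by
  \<open>q * \<alpha>\<close>, which is small modulo 1.\<close>

lemma birkhoff_commute:
  "birkhoff F \<alpha> q (x + real k * \<alpha>) - birkhoff F \<alpha> q x = birkhoff F \<alpha> k (x + real q * \<alpha>) - birkhoff F \<alpha> k x"
  using birkhoff_add[of F \<alpha> q k x] birkhoff_add[of F \<alpha> k q x] by (simp add: add.commute)

text \<open>A block of length \<open>q\<close> shifts along its own orbit at the cost of a sum of at most \<open>q\<close>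
  terms evaluated at a shift of size \<open>\<bar>q\<alpha> - p\<bar>\<close>, and this orbit is \<open>2/q\<close>-dense.\<close>

lemma birkhoff_block_osc:
  assumes F: "osc_diff K F" "continuous_on UNIV F" "\<And>x. F (x + 1) = F x"
    and q: "q > 0" "coprime p (int q)" "\<bar>\<alpha> - real_of_int p / real q\<bar> \<le> 1 / (real q)\<^sup>2"
    and e: "\<And>k x. k < q \<Longrightarrow>
      \<bar>birkhoff F \<alpha> k (x + (real q * \<alpha> - real_of_int p)) - birkhoff F \<alpha> k x\<bar> \<le> e"
  shows "\<bar>birkhoff F \<alpha> q x - birkhoff F \<alpha> q y\<bar> \<le> 4 * K / real q + e"
proof -
  obtain k n where k: "k < q" "\<bar>(x - y) - real k * \<alpha> - real_of_int n\<bar> \<le> 2 / real q"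
    using rotation_dense[OF q, of "x - y"] by blast
  define \<tau> where "\<tau> = (x - y) - real k * \<alpha> - real_of_int n"
  have x: "x = y + real k * \<alpha> + \<tau> + of_int n" by (simp add: \<tau>_def)
  have "\<bar>birkhoff F \<alpha> q x - birkhoff F \<alpha> q (y + real k * \<alpha>)\<bar> \<le> 2 * K * \<bar>\<tau>\<bar>"
    unfolding x birkhoff_periodic[of F, OF F(3)] by (rule denjoy_koksma[OF F q])
  also have "\<dots> \<le> 2 * K * (2 / real q)"
    using k osc_diff_nonneg[OF F(1)] by (intro mult_left_mono) (auto simp: \<tau>_def)
  finally have 1: "\<bar>birkhoff F \<alpha> q x - birkhoff F \<alpha> q (y + real k * \<alpha>)\<bar> \<le> 4 * K / real q" by simp
  \<comment> \<open>Periodicity replaces the shift \<open>q * \<alpha>\<close> by its small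
    remainder after subtracting \<open>p\<close>.\<close>
  have "birkhoff F \<alpha> k (y + real q * \<alpha>) = birkhoff F \<alpha> k (y + (real q * \<alpha> - real_of_int p))"
    using birkhoff_periodic[of F, OF F(3), of \<alpha> k "y + (real q * \<alpha> - real_of_int p)" p] by simp
  then have "\<bar>birkhoff F \<alpha> q (y + real k * \<alpha>) - birkhoff F \<alpha> q y\<bar> \<le> e"
    unfolding birkhoff_commute using e[OF k(1), of y] by simp
  with 1 show ?thesis by linarith
qed

text \<open>The Birkhoff sum has integral \<open>q * m\<close> over a period, so integrating the
  pairwise bound in one variable compares the value at \<open>x\<close> with the mean.\<close>

lemma birkhoff_mean:
  assumes I: "\<And>\<theta>. ((\<lambda>x. F (x + \<theta>)) has_integral m) {0..1}"
    and osc: "\<And>x y. \<bar>birkhoff F \<alpha> q x - birkhoff F \<alpha> q y\<bar> \<le> e"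
  shows "\<bar>birkhoff F \<alpha> q x - real q * m\<bar> \<le> e"
proof -
  have int: "((\<lambda>y. birkhoff F \<alpha> q y) has_integral (\<Sum>u<q. m)) {0..1}"
    unfolding birkhoff_def by (rule has_integral_sum) (auto intro: I)
  have c: "((\<lambda>y :: real. c) has_integral c) {0..1}" for c :: real
    using has_integral_const_real[of c 0 1] by simp
  have "(\<Sum>u<q. m) \<le> birkhoff F \<alpha> q x + e"
    using osc[of x] by (intro has_integral_le[OF int c]) (auto simp: abs_le_iff algebra_simps)
  moreover have "birkhoff F \<alpha> q x - e \<le> (\<Sum>u<q. m)"
    using osc[of x] by (intro has_integral_le[OF c int]) (auto simp: abs_le_iff algebra_simps)
  ultimately show ?thesis by (simp add: abs_le_iff)
qed

theorem birkhoff_bounded: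
  fixes \<alpha> C K m :: real
  assumes F: "osc_diff K F" "continuous_on UNIV F" "\<And>x. F (x + 1) = F x"
    and I: "\<And>\<theta>. ((\<lambda>x. F (x + \<theta>)) has_integral m) {0..1}"
    and cf: "has_cf_expansion \<alpha> a"
    and C: "\<And>m' :: nat. (\<Sum>l=0..m'. real_of_int (a (l + 1)) / sqrt (real_of_int (cf_denom a l))
           * (\<Sum>k=1..l + 1. real_of_int (a k))) < C"
  shows "\<bar>birkhoff F \<alpha> N x - real N * m\<bar> \<le> 6 * K * C"
proof -
  have pos: "a k \<ge> 1" if "k \<ge> 1" for k
    using cf that by (simp add: has_cf_expansion_def)
  note dm = cf_denom_mono[of a, OF pos]
  have eq: "snd (cf_pair a l) = cf_denom a l" for l
    using cf_denom_eq_snd[of a l] pos by simp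
  define q where "q l = nat (cf_denom a l)" for l
  \<comment> \<open>A negative \<open>a 0\<close> is truncated to 0 here; the transfer back to
    integers is therefore made for positive indices.\<close>
  define A where "A l = nat (a l)" for l
  define p where "p l = fst (cf_pair a l)" for l
  have iq: "int (q l) = cf_denom a l" for l using dm(1)[of l] by (simp add: q_def)
  have iA: "int (A (Suc l)) = a (Suc l)" for l using pos[of "Suc l"] by (simp add: A_def)
  have rq: "real_of_int (cf_denom a l) = real (q l)" for l using iq[of l] by (metis of_int_of_nat_eq)
  have rA: "real_of_int (a (Suc l)) = real (A (Suc l))" for l using iA[of l] by (metis of_int_of_nat_eq)
  have q0: "q 0 = 1" by (simp add: q_def cf_denom_def)
  have q1: "q l \<ge> 1" for l using dm(1)[of l] iq[of l] by linarith
  have q1': "q l > 0" for l using q1[of l] by linarith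
  have qmono: "q l \<le> q (Suc l)" for l using dm(2)[of l] unfolding iq[symmetric] by simp
  have qS: "q (Suc l) \<ge> A (Suc l) * q l" for l
    using dm(3)[of l] unfolding iq[symmetric] iA[symmetric] by (simp only: of_nat_mult[symmetric] of_nat_le_iff)
  have qS': "q (Suc l) \<le> (A (Suc l) + 1) * q l" for l
  proof -
    have "int (q (Suc l)) \<le> int ((A (Suc l) + 1) * q l)"
      using dm(4)[of l] unfolding iq[symmetric] iA[symmetric] by (simp add: algebra_simps)
    then show ?thesis by (simp only: of_nat_le_iff)
  qed
  have A1: "A (Suc l) \<ge> 1" for l using pos[of "Suc l"] iA[of l] by simp
  have cop: "coprime (p l) (int (q l))" for l
    using cf_pair_coprime[of a l] by (simp add: p_def iq eq)
  have apx: "\<bar>real (q l) * \<alpha> - p l\<bar> \<le> 1 / real (q (Suc l))" for l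
    using cf_pair_approx[OF cf, of l] unfolding eq rq p_def by (simp add: mult.commute)
  have \<delta>: "\<bar>\<alpha> - p l / q l\<bar> \<le> 1 / (real (q l))\<^sup>2" for l
  proof -
    have "1 / real (q (Suc l)) \<le> 1 / real (q l)" using q1'[of l] qmono[of l] by (simp add: frac_le)
    with apx[of l] have "\<bar>real (q l) * \<alpha> - p l\<bar> \<le> 1 / real (q l)" by linarith
    then have "\<bar>real (q l) * \<alpha> - p l\<bar> / q l \<le> 1 / real (q l) / q l" by (rule divide_right_mono) simp
    moreover have "\<bar>real (q l) * \<alpha> - p l\<bar> / q l = \<bar>(real (q l) * \<alpha> - p l) / q l\<bar>" by simp
    moreover have "(real (q l) * \<alpha> - p l) / q l = \<alpha> - p l / q l" using q1'[of l] by (simp add: field_simps)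
    ultimately show ?thesis by (simp add: power2_eq_square)
  qed
  have K: "K \<ge> 0" using osc_diff_nonneg[OF F(1)] .
  \<comment> \<open>First pass of Ostrowski's numeration, applied to the increment with mean 0 and
    block error \<open>2 * K * \<bar>\<tau>\<bar>\<close>.\<close>
  have short: "\<bar>birkhoff F \<alpha> k (x + \<tau>) - birkhoff F \<alpha> k x\<bar> \<le> (\<Sum>i<l. real (A (Suc i)) * (2 * K * \<bar>\<tau>\<bar>))"
    if "k < q l" for k x \<tau> l
  proof -
    have b: "birkhoff (\<lambda>x. F (x + \<tau>) - F x) \<alpha> N x = birkhoff F \<alpha> N (x + \<tau>) - birkhoff F \<alpha> N x" for N x
      by (simp add: birkhoff_def sum_subtractf add_ac)
    have "\<bar>birkhoff (\<lambda>x. F (x + \<tau>) - F x) \<alpha> k x - real k * 0\<bar> \<le> (\<Sum>i<l. real (A (Suc i)) * (2 * K * \<bar>\<tau>\<bar>))"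
      using denjoy_koksma[OF F q1' cop \<delta>]
      by (intro ostrowski_bound[OF q0 q1 qS' _ that]) (simp add: b)
    then show ?thesis by (simp add: b)
  qed
  define S where "S l = (\<Sum>i<l. real (A (Suc i)))" for l
  \<comment> \<open>The first term pays for the gap to the nearest orbit point, the second for the
    move along the orbit, a shift of at most \<open>1 / q (Suc l)\<close>.\<close>
  define e where "e l = 4 * K / real (q l) + 2 * K * S l / real (q (Suc l))" for l
  have S0: "S l \<ge> 0" for l by (auto simp: S_def intro: sum_nonneg)
  have "\<bar>birkhoff F \<alpha> (q l) x - birkhoff F \<alpha> (q l) y\<bar> \<le> e l" for l x y
    unfolding e_def
  proof (rule birkhoff_block_osc[OF F q1' cop \<delta>])
    fix k x assume "k < q l"
    let ?\<tau> = "real (q l) * \<alpha> - p l"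
    have "\<bar>birkhoff F \<alpha> k (x + ?\<tau>) - birkhoff F \<alpha> k x\<bar> \<le> S l * (2 * K * \<bar>?\<tau>\<bar>)"
      using short[OF \<open>k < q l\<close>, of x ?\<tau>] by (simp add: S_def sum_distrib_right)
    also have "\<dots> \<le> S l * (2 * K * (1 / real (q (Suc l))))"
      using apx[of l] K S0[of l] by (intro mult_left_mono) auto
    finally show "\<bar>birkhoff F \<alpha> k (x + ?\<tau>) - birkhoff F \<alpha> k x\<bar> \<le> 2 * K * S l / real (q (Suc l))"
      by (simp add: algebra_simps)
  qed
  then have block: "\<bar>birkhoff F \<alpha> (q l) x - real (q l) * m\<bar> \<le> e l" for l x
    by (rule birkhoff_mean[OF I])
  obtain l where "N < q l"
  proof
    \<comment> \<open>The growth bound loses one index: the denominator at \<open>N + 2\<close> is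
      at least \<open>N + 1\<close>.\<close>
    show "N < q (Suc (Suc N))" using dm(5)[of "Suc N"] iq[of "Suc (Suc N)"] by linarith
  qed
  define c where "c i = real (A (Suc i)) / sqrt (real (q i)) * S (Suc i)" for i
  have c0: "c i \<ge> 0" for i using S0[of "Suc i"] by (simp add: c_def)
  \<comment> \<open>Both terms of \<open>e\<close> are reduced to
    \<open>A (Suc i) * S (Suc i) / q i\<close>, the first by \<open>S (Suc i) \<ge> 1\<close>, the
    second by \<open>A (Suc i) / q (Suc i) \<le> 1 / q i\<close>. The coefficients 4 and 2 add up to
    6, and \<open>q i \<ge> 1\<close> allows the passage to the square root.\<close>
  have Ae: "real (A (Suc i)) * e i \<le> 6 * K * c i" for i
  proof -
    have q: "real (q i) \<ge> 1" "real (q (Suc i)) > 0" using q1[of i] q1'[of "Suc i"] by simp_all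
    have S: "S i \<le> S (Suc i)" "S (Suc i) \<ge> 1"
      using A1[of i] S0[of i] by (simp_all add: S_def)
    have "real (A (Suc i)) / real (q (Suc i)) \<le> 1 / real (q i)"
      using qS[of i] q by (simp add: field_simps flip: of_nat_mult)
    then have "2 * K * S i * (real (A (Suc i)) / real (q (Suc i))) \<le> 2 * K * S i * (1 / real (q i))"
      using K S0[of i] by (intro mult_left_mono) auto
    also have "\<dots> \<le> 2 * K * (real (A (Suc i)) * S (Suc i)) * (1 / real (q i))"
      using K S0[of i] S A1[of i] mult_mono[of 1 "real (A (Suc i))" "S i" "S (Suc i)"]
      by (intro mult_right_mono mult_left_mono) auto
    finally have 1: "2 * K * S i * (real (A (Suc i)) / real (q (Suc i))) \<le>
      2 * K * (real (A (Suc i)) * S (Suc i)) * (1 / real (q i))" .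
    have 2: "4 * K * real (A (Suc i)) * 1 * (1 / real (q i)) \<le> 4 * K * real (A (Suc i)) * S (Suc i) * (1 / real (q i))"
      using K S by (intro mult_right_mono mult_left_mono) auto
    have "real (A (Suc i)) * e i =
      4 * K * real (A (Suc i)) * 1 * (1 / real (q i)) + 2 * K * S i * (real (A (Suc i)) / real (q (Suc i)))"
      by (simp add: e_def algebra_simps)
    also have "\<dots> \<le> 4 * K * real (A (Suc i)) * S (Suc i) * (1 / real (q i))
        + 2 * K * (real (A (Suc i)) * S (Suc i)) * (1 / real (q i))"
      using 2 1 by (rule add_mono)
    also have "\<dots> = 6 * K * (real (A (Suc i)) * S (Suc i)) * (1 / real (q i))"
      by algebra
    also have "\<dots> \<le> 6 * K * (real (A (Suc i)) * S (Suc i)) * (1 / sqrt (real (q i)))"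
    proof -
      have "sqrt (real (q i)) \<le> sqrt ((real (q i))\<^sup>2)"
        using q(1) by (intro real_sqrt_le_mono) (simp add: power2_eq_square)
      then have "sqrt (real (q i)) \<le> real (q i)" by simp
      then show ?thesis using q(1) K S by (intro mult_left_mono divide_left_mono) auto
    qed
    finally show ?thesis by (simp add: c_def algebra_simps)
  qed
  have cC: "(\<Sum>i<l. c i) \<le> C"
  proof -
    have "(\<Sum>k=1..i + 1. real_of_int (a k)) = S (Suc i)" for i
      unfolding S_def using sum.shift_bounds_cl_Suc_ivl[of "\<lambda>k. real_of_int (a k)" 0 i]
      by (simp add: rA lessThan_Suc_atMost atLeast0AtMost)
    then have "(\<Sum>i=0..l. c i) < C" using C[of l] by (simp add: c_def rA rq)
    moreover have "(\<Sum>i<l. c i) \<le> (\<Sum>i=0..l. c i)" using c0 by (intro sum_mono2) auto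
    ultimately show ?thesis by linarith
  qed
  have "\<bar>birkhoff F \<alpha> N x - real N * m\<bar> \<le> (\<Sum>i<l. real (A (Suc i)) * e i)"
    using ostrowski_bound[OF q0 q1 qS' block \<open>N < q l\<close>] .
  also have "\<dots> \<le> (\<Sum>i<l. 6 * K * c i)" by (intro sum_mono Ae)
  also have "\<dots> = 6 * K * (\<Sum>i<l. c i)" by (simp add: sum_distrib_left)
  also have "\<dots> \<le> 6 * K * C" using cC K by (intro mult_left_mono) auto
  finally show ?thesis .
qed

section \<open>Functions with a derivative of bounded variation\<close>

text \<open>The model function with one kink; its multiples absorb jumps of a derivative.\<close>

definition ramp :: "real \<Rightarrow> real \<Rightarrow> real" where
  "ramp c x = max 0 (x - c)"

lemma osc_diff_add:
  assumes "osc_diff K F" "osc_diff K' G"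
  shows "osc_diff (K + K') (\<lambda>x. F x + G x)"
  unfolding osc_diff_def
proof (intro allI impI)
  fix \<tau> x y z and q :: nat
  assume *: "q > 0"
    "\<forall>j<q. y j \<in> {x + real j / real q..x + real (Suc j) / real q}"
    "\<forall>j<q. z j \<in> {x + real j / real q..x + real (Suc j) / real q}"
  have "(\<Sum>j<q. \<bar>F (y j + \<tau>) + G (y j + \<tau>) - (F (y j) + G (y j)) - (F (z j + \<tau>) + G (z j + \<tau>) - (F (z j) + G (z j)))\<bar>)
    \<le> (\<Sum>j<q. \<bar>(F (y j + \<tau>) - F (y j)) - (F (z j + \<tau>) - F (z j))\<bar>
       + \<bar>(G (y j + \<tau>) - G (y j)) - (G (z j + \<tau>) - G (z j))\<bar>)"
    by (intro sum_mono) linarith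
  also have "\<dots> \<le> K * \<bar>\<tau>\<bar> + K' * \<bar>\<tau>\<bar>"
    unfolding sum.distrib using assms * unfolding osc_diff_def by (intro add_mono) blast+
  finally show "(\<Sum>j<q. \<bar>F (y j + \<tau>) + G (y j + \<tau>) - (F (y j) + G (y j)) - (F (z j + \<tau>) + G (z j + \<tau>) - (F (z j) + G (z j)))\<bar>)
    \<le> (K + K') * \<bar>\<tau>\<bar>" by (simp add: algebra_simps)
qed

lemma osc_diff_cmult:
  assumes "osc_diff K F"
  shows "osc_diff (\<bar>c\<bar> * K) (\<lambda>x. c * F x)"
  unfolding osc_diff_def
proof (intro allI impI)
  fix \<tau> x y z and q :: nat
  assume *: "q > 0"
    "\<forall>j<q. y j \<in> {x + real j / real q..x + real (Suc j) / real q}"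
    "\<forall>j<q. z j \<in> {x + real j / real q..x + real (Suc j) / real q}"
  have "(\<Sum>j<q. \<bar>c * F (y j + \<tau>) - c * F (y j) - (c * F (z j + \<tau>) - c * F (z j))\<bar>)
    = \<bar>c\<bar> * (\<Sum>j<q. \<bar>(F (y j + \<tau>) - F (y j)) - (F (z j + \<tau>) - F (z j))\<bar>)"
    unfolding sum_distrib_left abs_mult[symmetric] by (simp add: algebra_simps)
  also have "\<dots> \<le> \<bar>c\<bar> * (K * \<bar>\<tau>\<bar>)"
    using assms * unfolding osc_diff_def by (intro mult_left_mono) auto
  finally show "(\<Sum>j<q. \<bar>c * F (y j + \<tau>) - c * F (y j) - (c * F (z j + \<tau>) - c * F (z j))\<bar>)
    \<le> \<bar>c\<bar> * K * \<bar>\<tau>\<bar>" by simp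
qed

text \<open>The difference \<open>ramp c (x + \<tau>) - ramp c x\<close> is monotone in \<open>x\<close> with values between
  \<open>0\<close> and \<open>\<tau>\<close>, so its oscillations over consecutive intervals telescope.\<close>

lemma osc_diff_ramp: "osc_diff 1 (ramp c)"
  unfolding osc_diff_def
proof (intro allI impI)
  fix \<tau> x y z and q :: nat
  assume *: "q > 0"
    "\<forall>j<q. y j \<in> {x + real j / real q..x + real (Suc j) / real q}"
    "\<forall>j<q. z j \<in> {x + real j / real q..x + real (Suc j) / real q}"
  \<comment> \<open>With the absolute value the increment is nondecreasing for either sign of
    \<open>\<tau>\<close>, so one telescoping argument serves both.\<close>
  define D where "D u = \<bar>ramp c (u + \<tau>) - ramp c u\<bar>" for u
  have D: "0 \<le> D u" "D u \<le> \<bar>\<tau>\<bar>" for u unfolding D_def ramp_def by linarith+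
  have osc: "\<bar>(ramp c (u + \<tau>) - ramp c u) - (ramp c (v + \<tau>) - ramp c v)\<bar> \<le> D t - D s"
    if "u \<in> {s..t}" "v \<in> {s..t}" for s t u v
    using that unfolding D_def ramp_def by (auto simp: max_def abs_if split: if_splits)
  have "(\<Sum>j<q. \<bar>(ramp c (y j + \<tau>) - ramp c (y j)) - (ramp c (z j + \<tau>) - ramp c (z j))\<bar>)
    \<le> (\<Sum>j<q. D (x + real (Suc j) / real q) - D (x + real j / real q))"
    using * by (intro sum_mono osc) auto
  also have "\<dots> = D (x + real q / real q) - D x"
    by (subst sum_lessThan_telescope) simp
  also have "\<dots> \<le> 1 * \<bar>\<tau>\<bar>" using D(1)[of x] D(2)[of "x + real q / real q"] by linarith
  finally show "(\<Sum>j<q. \<bar>(ramp c (y j + \<tau>) - ramp c (y j)) - (ramp c (z j + \<tau>) - ramp c (z j))\<bar>)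
    \<le> 1 * \<bar>\<tau>\<bar>" .
qed

text \<open>Within a cell, \<open>F (y + s) - F (z + s)\<close> has derivative at most
  \<open>B / q\<close> in \<open>s\<close>; the mean value inequality on the way from 0 to
  \<open>\<tau>\<close>, summed over \<open>q\<close> cells, cancels the \<open>q\<close>.\<close>

lemma osc_diff_lipschitz_deriv:
  assumes "\<And>x. (F has_real_derivative g x) (at x)" "\<And>x y. \<bar>g x - g y\<bar> \<le> B * \<bar>x - y\<bar>"
  shows "osc_diff B F"
  unfolding osc_diff_def
proof (intro allI impI)
  fix \<tau> x y z and q :: nat
  assume *: "q > 0"
    "\<forall>j<q. y j \<in> {x + real j / real q..x + real (Suc j) / real q}"
    "\<forall>j<q. z j \<in> {x + real j / real q..x + real (Suc j) / real q}"
  have "B \<ge> 0" using assms(2)[of 1 0] by simp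
  have "\<bar>(F (y j + \<tau>) - F (y j)) - (F (z j + \<tau>) - F (z j))\<bar> \<le> B / real q * \<bar>\<tau>\<bar>" if "j < q" for j
  proof -
    have "\<bar>y j - z j\<bar> \<le> 1 / real q"
      using *(2,3) that by (fastforce simp: abs_le_iff add_divide_distrib)
    then have g: "\<bar>g (y j + s) - g (z j + s)\<bar> \<le> B / real q" for s
      using assms(2)[of "y j + s" "z j + s"] mult_left_mono[of "\<bar>y j - z j\<bar>" "1 / real q" B] \<open>B \<ge> 0\<close>
      by simp
    have "norm ((F (y j + \<tau>) - F (z j + \<tau>)) - (F (y j + 0) - F (z j + 0))) \<le> B / real q * norm (\<tau> - 0)"
    proof (rule field_differentiable_bound[of UNIV _ "\<lambda>s. g (y j + s) - g (z j + s)"])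
      fix s :: real
      have "((\<lambda>s. F (w + s)) has_real_derivative g (w + s)) (at s)" for w
        using DERIV_shift[of F "g (w + s)" s w] assms(1)[of "w + s"] by (simp add: add.commute)
      then show "((\<lambda>s. F (y j + s) - F (z j + s)) has_real_derivative g (y j + s) - g (z j + s)) (at s)"
        by (intro DERIV_diff)
      show "norm (g (y j + s) - g (z j + s)) \<le> B / real q" using g by simp
    qed auto
    then show ?thesis by (simp add: algebra_simps)
  qed
  then have "(\<Sum>j<q. \<bar>(F (y j + \<tau>) - F (y j)) - (F (z j + \<tau>) - F (z j))\<bar>) \<le> (\<Sum>j<q. B / real q * \<bar>\<tau>\<bar>)"
    by (intro sum_mono) auto
  also have "\<dots> = B * \<bar>\<tau>\<bar>" using *(1) by simp
  finally show "(\<Sum>j<q. \<bar>(F (y j + \<tau>) - F (y j)) - (F (z j + \<tau>) - F (z j))\<bar>) \<le> B * \<bar>\<tau>\<bar>" .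
qed

text \<open>The window coordinate gets divided by \<open>sqrt (1 + \<alpha>\<^sup>2)\<close>. Asking
  for a constant at every scale yields a class closed under linear combinations without tracking
  constants.\<close>

definition scalable_osc_diff :: "(real \<Rightarrow> real) \<Rightarrow> bool" where
  "scalable_osc_diff h \<longleftrightarrow> (\<forall>r>0. \<exists>K. osc_diff K (\<lambda>x. h (x / r)))"

lemma scalable_osc_diff_add:
  "scalable_osc_diff g \<Longrightarrow> scalable_osc_diff h \<Longrightarrow> scalable_osc_diff (\<lambda>x. g x + h x)"
  unfolding scalable_osc_diff_def using osc_diff_add by blast

lemma scalable_osc_diff_cmult:
  "scalable_osc_diff h \<Longrightarrow> scalable_osc_diff (\<lambda>x. c * h x)"
  unfolding scalable_osc_diff_def using osc_diff_cmult by blast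

lemma scalable_osc_diff_ramp: "scalable_osc_diff (ramp c)"
  unfolding scalable_osc_diff_def
proof (intro allI impI)
  fix r :: real assume r: "r > 0"
  have "ramp c (x / r) = 1 / r * ramp (c * r) x" for x
    using r by (auto simp: ramp_def max_def field_simps)
  then show "\<exists>K. osc_diff K (\<lambda>x. ramp c (x / r))"
    using osc_diff_cmult[OF osc_diff_ramp, of "1 / r" "c * r"] by auto
qed

lemma scalable_osc_diff_lipschitz_deriv:
  assumes "\<And>x. (F has_real_derivative g x) (at x)" "\<And>x y. \<bar>g x - g y\<bar> \<le> B * \<bar>x - y\<bar>"
  shows "scalable_osc_diff F"
  unfolding scalable_osc_diff_def
proof (intro allI impI exI)
  fix r :: real assume r: "r > 0"
  show "osc_diff (B / r / r) (\<lambda>x. F (x / r))"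
  proof (rule osc_diff_lipschitz_deriv)
    show "((\<lambda>x. F (x / r)) has_real_derivative g (x / r) * (1 / r)) (at x)" for x
      by (rule DERIV_chain2[OF assms(1)]) (use r in \<open>auto intro!: derivative_eq_intros\<close>)
    fix x y
    have "\<bar>g (x / r) * (1 / r) - g (y / r) * (1 / r)\<bar> = \<bar>g (x / r) - g (y / r)\<bar> * (1 / r)"
      using r by (simp add: abs_mult flip: diff_divide_distrib)
    also have "\<dots> \<le> B * \<bar>x / r - y / r\<bar> * (1 / r)"
      using r by (intro mult_right_mono assms) auto
    also have "\<dots> = B / r / r * \<bar>x - y\<bar>"
      using r by (simp flip: diff_divide_distrib)
    finally show "\<bar>g (x / r) * (1 / r) - g (y / r) * (1 / r)\<bar> \<le> B / r / r * \<bar>x - y\<bar>" .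
  qed
qed

section \<open>Piecewise linear functions as affine functions plus ramps\<close>

lemma affine_coeffs_unique:
  fixes c d c' d' :: real
  assumes "s < t" "\<And>x. s < x \<Longrightarrow> x < t \<Longrightarrow> c * x + d = c' * x + d'"
  shows "c = c' \<and> d = d'"
proof -
  obtain u where u: "s < u" "u < t" using dense[OF assms(1)] by blast
  obtain v where v: "u < v" "v < t" using dense[OF u(2)] by blast
  have "(c - c') * (v - u) = 0"
    using assms(2)[of u] assms(2)[of v] u v by (simp add: algebra_simps)
  then have "c = c'" using v by simp
  then show ?thesis using assms(2)[of u] u by simp
qed

text \<open>Recording the possible kinks as a set \<open>E\<close>, instead of listing the pieces,
  permits induction that removes one kink at a time.\<close>

definition affine_off :: "real set \<Rightarrow> (real \<Rightarrow> real) \<Rightarrow> bool" where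
  "affine_off E h \<longleftrightarrow> (\<forall>s t. s < t \<longrightarrow> {s<..<t} \<inter> E = {} \<longrightarrow> (\<exists>c d. \<forall>x\<in>{s<..<t}. h x = c * x + d))"

text \<open>The factor \<open>k\<close> is the jump \<open>c2 - c1\<close> of the slope at
  \<open>e\<close>. By continuity the two affine pieces agree at \<open>e\<close>, so after the
  subtraction the left formula continues past \<open>e\<close>.\<close>

lemma affine_off_remove:
  assumes h: "continuous_on UNIV h" "affine_off (insert e E) h" and E: "finite E" "e \<notin> E"
  shows "\<exists>k. affine_off E (\<lambda>x. h x - k * ramp e x)"
proof -
  have "open (- E)" using E(1) by (simp add: finite_imp_closed open_Compl)
  then obtain \<epsilon> where \<epsilon>: "\<epsilon> > 0" "ball e \<epsilon> \<subseteq> - E"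
    using E(2) open_contains_ball by blast
  have "{e-\<epsilon><..<e} \<inter> insert e E = {}" "{e<..<e+\<epsilon>} \<inter> insert e E = {}"
    using \<epsilon>(2) by (auto simp: subset_iff dist_real_def)
  then obtain c1 d1 c2 d2 where 1: "\<And>x. x \<in> {e-\<epsilon><..<e} \<Longrightarrow> h x = c1 * x + d1"
    and 2: "\<And>x. x \<in> {e<..<e+\<epsilon>} \<Longrightarrow> h x = c2 * x + d2"
    using h(2) \<epsilon>(1) unfolding affine_off_def by (metis diff_less_eq less_add_same_cancel1)
  have cl: "h e = c * e + d" if "s < t" "e \<in> {s..t}" "\<And>x. x \<in> {s<..<t} \<Longrightarrow> h x = c * x + d" for c d s t
  proof -
    have "closed {x. h x = c * x + d}"
      by (intro closed_Collect_eq continuous_intros h(1))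
    then have "closure {s<..<t} \<subseteq> {x. h x = c * x + d}"
      using that(3) by (intro closure_minimal) auto
    then show ?thesis using that(1,2) by auto
  qed
  have e1: "h e = c1 * e + d1" by (rule cl[of "e - \<epsilon>" e]) (use 1 \<epsilon>(1) in auto)
  have e2: "h e = c2 * e + d2" by (rule cl[of e "e + \<epsilon>"]) (use 2 \<epsilon>(1) in auto)
  have "\<exists>c d. \<forall>x\<in>{s<..<t}. h x - (c2 - c1) * ramp e x = c * x + d"
    if st: "s < t" "{s<..<t} \<inter> E = {}" for s t
  proof (cases "e \<in> {s<..<t}")
    case False
    then have "{s<..<t} \<inter> insert e E = {}" using st by auto
    then obtain c d where cd: "\<And>x. x \<in> {s<..<t} \<Longrightarrow> h x = c * x + d"
      using h(2) st(1) unfolding affine_off_def by meson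
    show ?thesis
    proof (cases "e \<le> s")
      case True
      then have "\<forall>x\<in>{s<..<t}. h x - (c2 - c1) * ramp e x = (c - (c2 - c1)) * x + (d + (c2 - c1) * e)"
        using cd by (auto simp: ramp_def max_def algebra_simps)
      then show ?thesis by blast
    next
      case False
      then have "\<forall>x\<in>{s<..<t}. h x - (c2 - c1) * ramp e x = c * x + d"
        using cd \<open>e \<notin> {s<..<t}\<close> by (auto simp: ramp_def max_def)
      then show ?thesis by blast
    qed
  next
    case True
    then have "{s<..<e} \<inter> insert e E = {}" "{e<..<t} \<inter> insert e E = {}"
      using st by (auto simp: disjoint_iff)
    then obtain c d c' d' where cd: "\<And>x. x \<in> {s<..<e} \<Longrightarrow> h x = c * x + d"
      and cd': "\<And>x. x \<in> {e<..<t} \<Longrightarrow> h x = c' * x + d'"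
      using h(2) True unfolding affine_off_def by (metis greaterThanLessThan_iff)
    \<comment> \<open>The given interval and the \<open>\<epsilon>\<close>-neighbourhood overlap on
      each side of \<open>e\<close>, which forces equal coefficients.\<close>
    have l: "c = c1 \<and> d = d1"
      by (rule affine_coeffs_unique[of "max s (e-\<epsilon>)" e]) (use 1 cd True \<epsilon>(1) in force)+
    have r: "c' = c2 \<and> d' = d2"
      by (rule affine_coeffs_unique[of e "min t (e+\<epsilon>)"]) (use 2 cd' True \<epsilon>(1) in force)+
    have "h x - (c2 - c1) * ramp e x = c1 * x + d1" if "x \<in> {s<..<t}" for x
    proof (cases x e rule: linorder_cases)
      case less
      then show ?thesis using cd that l by (simp add: ramp_def)
    next
      case equal
      then show ?thesis using e1 by (simp add: ramp_def)
    next
      case greater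
      then show ?thesis using cd' that r e1 e2 by (simp add: ramp_def algebra_simps)
    qed
    then show ?thesis by blast
  qed
  then show ?thesis unfolding affine_off_def by blast
qed

lemma scalable_osc_diff_affine: "scalable_osc_diff (\<lambda>x. c * x + d)"
  by (rule scalable_osc_diff_lipschitz_deriv[of _ "\<lambda>_. c" 0]) (auto intro!: derivative_eq_intros)

text \<open>Coefficients are provided on bounded intervals one at a time; comparison with those on
  \<open>(-1, 1)\<close> makes them global.\<close>

lemma affine_off_empty:
  assumes "affine_off {} h"
  shows "\<exists>c d. \<forall>x. h x = c * x + d"
proof -
  obtain c d where cd: "\<And>x. x \<in> {-1<..<1} \<Longrightarrow> h x = c * x + d"
    using assms[unfolded affine_off_def, rule_format, of "-1" 1] by auto
  have "h x = c * x + d" for x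
  proof -
    have "- \<bar>x\<bar> - 2 < \<bar>x\<bar> + 2" by linarith
    then obtain c' d' where cd': "\<And>y. y \<in> {- \<bar>x\<bar> - 2<..<\<bar>x\<bar> + 2} \<Longrightarrow> h y = c' * y + d'"
      using assms unfolding affine_off_def by (metis Int_empty_right)
    have "c = c' \<and> d = d'"
    proof (rule affine_coeffs_unique[of "-1" 1])
      fix y :: real assume "-1 < y" "y < 1"
      moreover from this have "y \<in> {- \<bar>x\<bar> - 2<..<\<bar>x\<bar> + 2}" unfolding greaterThanLessThan_iff by linarith
      ultimately show "c * y + d = c' * y + d'" using cd[of y] cd'[of y] by simp
    qed simp
    then show ?thesis using cd'[of x] by (auto simp: abs_if)
  qed
  then show ?thesis by blast
qed

lemma continuous_on_ramp: "continuous_on S (ramp c)"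
  unfolding ramp_def by (intro continuous_intros)

lemma scalable_osc_diff_affine_off:
  assumes "finite E" "continuous_on UNIV h" "affine_off E h"
  shows "scalable_osc_diff h"
  using assms
proof (induction E arbitrary: h rule: finite_induct)
  case empty
  then obtain c d where "\<And>x. h x = c * x + d" using affine_off_empty by blast
  then have "h = (\<lambda>x. c * x + d)" by blast
  then show ?case using scalable_osc_diff_affine by simp
next
  case (insert e E)
  obtain k where k: "affine_off E (\<lambda>x. h x - k * ramp e x)"
    using affine_off_remove[OF insert.prems insert.hyps] by blast
  have "scalable_osc_diff (\<lambda>x. h x - k * ramp e x)"
    by (intro insert.IH k continuous_intros continuous_on_ramp insert.prems)
  from scalable_osc_diff_add[OF this scalable_osc_diff_cmult[OF scalable_osc_diff_ramp[of e], of k]]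
  show ?case by simp
qed

lemma finite_frontier_interval:
  fixes I :: "real set"
  assumes "is_interval I"
  shows "finite (frontier I)"
proof -
  obtain a b :: real where "I = {} \<or> I = UNIV \<or> I = {..<b} \<or> I = {..b} \<or> I = {a<..} \<or> I = {a..} \<or>
    I = {a<..<b} \<or> I = {a<..b} \<or> I = {a..<b} \<or> I = {a..b}"
    using is_real_interval[OF assms] by blast
  \<comment> \<open>In every shape of interval, \<open>a\<close> or \<open>b\<close> separates an
    inner from an outer point. A frontier point away from both would have inner and outer points
    nearby that neither \<open>a\<close> nor \<open>b\<close> separates.\<close>
  moreover have "x \<in> {a, b}" if fr: "x \<in> frontier I" and *: "\<And>y z. y \<in> I \<Longrightarrow> z \<notin> I \<Longrightarrow>
      y < a \<and> a \<le> z \<or> y \<le> a \<and> a < z \<or> z < a \<and> a \<le> y \<or> z \<le> a \<and> a < y \<or>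
      y < b \<and> b \<le> z \<or> y \<le> b \<and> b < z \<or> z < b \<and> b \<le> y \<or> z \<le> b \<and> b < y" for x
  proof (rule ccontr)
    assume "x \<notin> {a, b}"
    define e where "e = min \<bar>x - a\<bar> \<bar>x - b\<bar>"
    have "e > 0" using \<open>x \<notin> {a, b}\<close> by (simp add: e_def)
    then obtain y z where yz: "y \<in> I" "dist x y < e" "z \<notin> I" "dist x z < e"
      using fr unfolding frontier_straddle by blast
    then have "\<bar>x - y\<bar> < \<bar>x - a\<bar>" "\<bar>x - y\<bar> < \<bar>x - b\<bar>" "\<bar>x - z\<bar> < \<bar>x - a\<bar>" "\<bar>x - z\<bar> < \<bar>x - b\<bar>"
      by (auto simp: e_def dist_real_def)
    then show False using *[OF yz(1,3)] by linarith
  qed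
  ultimately have "frontier I \<subseteq> {a, b}"
    by (elim disjE; intro subsetI) force+
  then show ?thesis using finite_subset by blast
qed

lemma scalable_osc_diff_piecewise_linear:
  assumes "piecewise_linear h" "continuous_on UNIV h"
  shows "scalable_osc_diff h"
proof -
  obtain P where P: "finite P" "\<Union>P = UNIV" "\<And>I. I \<in> P \<Longrightarrow> is_interval I"
    "\<And>I. I \<in> P \<Longrightarrow> \<exists>c d. \<forall>x\<in>I. h x = c * x + d"
    using assms(1) unfolding piecewise_linear_def by auto
  have "affine_off (\<Union>I\<in>P. frontier I) h"
    unfolding affine_off_def
  proof (intro allI impI)
    fix s t :: real assume st: "s < t" "{s<..<t} \<inter> (\<Union>I\<in>P. frontier I) = {}"
    obtain x where x: "x \<in> {s<..<t}" using dense[OF st(1)] by auto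
    then obtain I where I: "I \<in> P" "x \<in> I" using P(2) by blast
    \<comment> \<open>A connected set that meets \<open>I\<close> and avoids its frontier stays
      inside \<open>I\<close>.\<close>
    have "{s<..<t} - I = {}"
      using connected_Int_frontier[OF connected_Ioo, of s t I] x I st(2) by blast
    then show "\<exists>c d. \<forall>x\<in>{s<..<t}. h x = c * x + d" using P(4)[OF I(1)] by blast
  qed
  then show ?thesis
    using P(1,3) assms(2) by (intro scalable_osc_diff_affine_off[of "\<Union>I\<in>P. frontier I"])
      (auto intro: finite_frontier_interval)
qed

section \<open>Functions with bounded second derivative on the window\<close>

lemma has_field_derivative_Un:
  assumes "(f has_field_derivative D) (at x within S)" "(f has_field_derivative D) (at x within T)"
  shows "(f has_field_derivative D) (at x within S \<union> T)"
  using assms unfolding has_field_derivative_iff unfolding at_within_union by (rule filterlim_sup)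

text \<open>The filter is trivial there. A two-sided derivative can thus be pasted from closed
  pieces without first asking which of them contain the point.\<close>

lemma has_field_derivative_within_closed_outside:
  fixes x :: "'a :: real_normed_field"
  assumes "closed S" "x \<notin> S"
  shows "(f has_field_derivative D) (at x within S)"
proof -
  have "at x within S = bot" using assms by (simp add: at_within_eq_bot_iff closure_closed)
  then show ?thesis by (simp add: has_field_derivative_iff)
qed

text \<open>Subtracting two ramps removes the jumps of \<open>h'\<close> at \<open>a\<close> and \<open>b\<close> and leaves a function whose
  derivative is globally Lipschitz.\<close>

lemma scalable_osc_diff_second_derivative:
  assumes h: "continuous_on UNIV h" "\<And>x. x \<notin> {a..b} \<Longrightarrow> h x = 0" and "a < b"
    and b2: "bounded_second_derivative_on h {a..b}"
  shows "scalable_osc_diff h"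
proof -
  obtain h' h'' where h': "\<And>x. x \<in> {a..b} \<Longrightarrow> (h has_real_derivative h' x) (at x within {a..b})"
    and h'': "\<And>x. x \<in> {a..b} \<Longrightarrow> (h' has_real_derivative h'' x) (at x within {a..b})"
    and bdd: "bounded (h'' ` {a..b})"
    using b2 unfolding bounded_second_derivative_on_def by blast
  from bdd obtain B where "\<forall>y\<in>h'' ` {a..b}. norm y \<le> B" unfolding bounded_iff by blast
  then have B: "\<bar>h'' x\<bar> \<le> B" if "x \<in> {a..b}" for x using that by auto
  have "B \<ge> 0" using B[of a] \<open>a < b\<close> by simp
  have "closed {x. h x = 0}" by (intro closed_Collect_eq continuous_intros h(1))
  then have cl: "closure (- {a..b}) \<subseteq> {x. h x = 0}" using h(2) by (intro closure_minimal) auto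
  have "- {a..b} = {..<a} \<union> {b<..}" by auto
  then have "closure (- {a..b}) = {..a} \<union> {b..}" by (simp add: closure_Un)
  then have h0: "h x = 0" if "x \<le> a \<or> x \<ge> b" for x using cl that by auto
  \<comment> \<open>Composition with \<open>clamp\<close> continues \<open>h'\<close> by its end
    values; as \<open>clamp\<close> is 1-Lipschitz, \<open>g\<close> keeps the Lipschitz constant
    \<open>B\<close>.\<close>
  define clamp where "clamp x = max a (min b x)" for x
  define g where "g x = h' (clamp x) - h' a" for x
  \<comment> \<open>Left of \<open>a\<close> both ramps vanish; right of \<open>b\<close> their
    combined slope is \<open>h' b - h' a\<close>. These are the values of \<open>g\<close>
    there.\<close>
  define F where "F x = h x - h' a * ramp a x + h' b * ramp b x" for x
  have "(F has_real_derivative g x) (at x)" for x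
  proof -
    have "(F has_real_derivative g x) (at x within {..a})"
    proof (cases "x \<in> {..a}")
      case True
      have "((\<lambda>_. 0) has_real_derivative g x) (at x within {..a})"
        using True \<open>a < b\<close> by (simp add: g_def clamp_def)
      then show ?thesis
        by (rule has_field_derivative_transform_within[OF _ zero_less_one True])
          (use h0 \<open>a < b\<close> in \<open>auto simp: F_def ramp_def\<close>)
    qed (simp add: has_field_derivative_within_closed_outside)
    moreover have "(F has_real_derivative g x) (at x within {a..b})"
    proof (cases "x \<in> {a..b}")
      case True
      have "((\<lambda>x. h x - h' a * (x - a)) has_real_derivative g x) (at x within {a..b})"
        using True by (auto intro!: derivative_eq_intros h' simp: g_def clamp_def)
      then show ?thesis
        by (rule has_field_derivative_transform_within[OF _ zero_less_one True])
          (auto simp: F_def ramp_def)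
    qed (simp add: has_field_derivative_within_closed_outside)
    moreover have "(F has_real_derivative g x) (at x within {b..})"
    proof (cases "x \<in> {b..}")
      case True
      have "((\<lambda>x. - h' a * (x - a) + h' b * (x - b)) has_real_derivative g x) (at x within {b..})"
        using True \<open>a < b\<close> by (auto intro!: derivative_eq_intros simp: g_def clamp_def)
      then show ?thesis
        by (rule has_field_derivative_transform_within[OF _ zero_less_one True])
          (use h0 \<open>a < b\<close> in \<open>auto simp: F_def ramp_def\<close>)
    qed (simp add: has_field_derivative_within_closed_outside)
    ultimately have "(F has_real_derivative g x) (at x within {..a} \<union> {a..b} \<union> {b..})"
      by (intro has_field_derivative_Un)
    moreover have "{..a} \<union> {a..b} \<union> {b..} = (UNIV :: real set)" by auto
    ultimately show ?thesis by simp
  qed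
  moreover have "\<bar>g x - g y\<bar> \<le> B * \<bar>x - y\<bar>" for x y
  proof -
    have "norm (h' (clamp x) - h' (clamp y)) \<le> B * norm (clamp x - clamp y)"
      by (rule field_differentiable_bound[of "{a..b}" _ h'']) (use h'' B \<open>a < b\<close> in \<open>auto simp: clamp_def\<close>)
    also have "\<dots> \<le> B * \<bar>x - y\<bar>"
      using \<open>B \<ge> 0\<close> by (intro mult_left_mono) (auto simp: clamp_def max_def min_def)
    finally show ?thesis by (simp add: g_def)
  qed
  ultimately have "scalable_osc_diff F" by (rule scalable_osc_diff_lipschitz_deriv)
  from scalable_osc_diff_add[OF scalable_osc_diff_add[OF this
      scalable_osc_diff_cmult[OF scalable_osc_diff_ramp[of a], of "h' a"]]
      scalable_osc_diff_cmult[OF scalable_osc_diff_ramp[of b], of "- h' b"]]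
  show ?thesis by (simp add: F_def)
qed

section \<open>Periodization\<close>

text \<open>Restricting to nonzero terms gives a finite index set whenever \<open>f\<close> has
  bounded support; over an infinite set the sum would default to 0.\<close>

definition periodize :: "(real \<Rightarrow> real) \<Rightarrow> real \<Rightarrow> real" where
  "periodize f x = (\<Sum>v :: int | f (x + of_int v) \<noteq> 0. f (x + of_int v))"

lemma periodize_eq:
  assumes "finite A" "\<And>v. f (x + of_int v) \<noteq> 0 \<Longrightarrow> v \<in> A"
  shows "periodize f x = (\<Sum>v\<in>A. f (x + of_int v))"
  unfolding periodize_def using assms by (intro sum.mono_neutral_left) auto

lemma periodize_periodic: "periodize f (x + 1) = periodize f x"
proof -
  have "bij_betw (\<lambda>v. v + 1) {v :: int. f (x + 1 + of_int v) \<noteq> 0} {v. f (x + of_int v) \<noteq> 0}"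
    by (rule bij_betw_byWitness[of _ "\<lambda>v. v - 1"]) (auto simp: algebra_simps)
  from sum.reindex_bij_betw[OF this, of "\<lambda>v. f (x + of_int v)"] show ?thesis
    by (simp add: periodize_def algebra_simps)
qed

text \<open>One index set serves a whole unit interval of base points, and its size does not depend
  on \<open>x\<close>.\<close>

definition shifts :: "nat \<Rightarrow> real \<Rightarrow> int set" where
  "shifts R x = {- int R - \<lfloor>x\<rfloor> - 2..int R - \<lfloor>x\<rfloor>}"

lemma in_shifts:
  assumes "\<And>x. \<bar>x\<bar> > real R \<Longrightarrow> f x = 0" "f (y + of_int v) \<noteq> 0" "x \<le> y" "y \<le> x + 1"
  shows "v \<in> shifts R x"
proof -
  have "\<bar>y + of_int v\<bar> \<le> real R" using assms(1,2) by (meson not_le)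
  then have "of_int v \<le> real R - y" "of_int v \<ge> - real R - y" by (auto simp: abs_le_iff)
  then show ?thesis using assms(3,4) unfolding shifts_def by (simp; linarith)
qed

lemma finite_shifts: "finite (shifts R x)" by (simp add: shifts_def)

lemma card_shifts: "card (shifts R x) = 2 * R + 3" by (simp add: shifts_def)

text \<open>Over a unit interval and its translate by \<open>\<tau>\<close> the periodization is a
  sum over two sets of \<open>2 * R + 3\<close> shifts, and each shift contributes at most
  \<open>K * \<bar>\<tau>\<bar>\<close>.\<close>

lemma osc_diff_periodize:
  assumes f: "osc_diff K f" "\<And>x. \<bar>x\<bar> > real R \<Longrightarrow> f x = 0"
  shows "osc_diff (real (4 * R + 6) * K) (periodize f)"
  unfolding osc_diff_def
proof (intro allI impI)
  fix \<tau> x y z and q :: nat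
  assume *: "q > 0"
    "\<forall>j<q. y j \<in> {x + real j / real q..x + real (Suc j) / real q}"
    "\<forall>j<q. z j \<in> {x + real j / real q..x + real (Suc j) / real q}"
  define A where "A = shifts R x \<union> shifts R (x + \<tau>)"
  have A: "finite A" "card A \<le> 4 * R + 6"
    using card_Un_le[of "shifts R x" "shifts R (x + \<tau>)"] by (simp_all add: A_def finite_shifts card_shifts)
  have eq: "periodize f w = (\<Sum>v\<in>A. f (w + of_int v))" "periodize f (w + \<tau>) = (\<Sum>v\<in>A. f (w + of_int v + \<tau>))"
    if "j < q" "w \<in> {x + real j / real q..x + real (Suc j) / real q}" for j w
  proof -
    have "real (Suc j) / real q \<le> 1" using that(1) by simp
    moreover have "0 \<le> real j / real q" by simp
    ultimately have w: "x \<le> w" "w \<le> x + 1" using that(2) unfolding atLeastAtMost_iff by linarith+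
    show "periodize f w = (\<Sum>v\<in>A. f (w + of_int v))"
      using in_shifts[of R f w _ x, OF f(2)] w by (intro periodize_eq A) (auto simp: A_def)
    have "periodize f (w + \<tau>) = (\<Sum>v\<in>A. f (w + \<tau> + of_int v))"
      using in_shifts[of R f "w + \<tau>" _ "x + \<tau>", OF f(2)] w by (intro periodize_eq A) (auto simp: A_def)
    then show "periodize f (w + \<tau>) = (\<Sum>v\<in>A. f (w + of_int v + \<tau>))" by (simp add: add_ac)
  qed
  have "(\<Sum>j<q. \<bar>periodize f (y j + \<tau>) - periodize f (y j) - (periodize f (z j + \<tau>) - periodize f (z j))\<bar>)
    = (\<Sum>j<q. \<bar>\<Sum>v\<in>A. f (y j + of_int v + \<tau>) - f (y j + of_int v) - (f (z j + of_int v + \<tau>) - f (z j + of_int v))\<bar>)"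
    using * by (intro sum.cong) (simp_all add: eq sum_subtractf)
  also have "\<dots> \<le> (\<Sum>j<q. \<Sum>v\<in>A. \<bar>f (y j + of_int v + \<tau>) - f (y j + of_int v) - (f (z j + of_int v + \<tau>) - f (z j + of_int v))\<bar>)"
    by (intro sum_mono sum_abs)
  also have "\<dots> = (\<Sum>v\<in>A. \<Sum>j<q. \<bar>f (y j + of_int v + \<tau>) - f (y j + of_int v) - (f (z j + of_int v + \<tau>) - f (z j + of_int v))\<bar>)"
    by (rule sum.swap)
  also have "\<dots> \<le> (\<Sum>v\<in>A. K * \<bar>\<tau>\<bar>)"
  proof (rule sum_mono)
    fix v
    show "(\<Sum>j<q. \<bar>f (y j + of_int v + \<tau>) - f (y j + of_int v) - (f (z j + of_int v + \<tau>) - f (z j + of_int v))\<bar>) \<le> K * \<bar>\<tau>\<bar>"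
      using f(1)[unfolded osc_diff_def, THEN spec[of _ \<tau>], THEN spec[of _ "x + of_int v"],
          THEN spec[of _ "\<lambda>j. y j + of_int v"], THEN spec[of _ "\<lambda>j. z j + of_int v"], THEN spec[of _ q]]
    proof (elim mp[OF mp[OF mp]])
      show "\<forall>j<q. y j + of_int v \<in> {x + of_int v + real j / real q..x + of_int v + real (Suc j) / real q}"
        using *(2) by (auto simp del: of_nat_Suc)
      show "\<forall>j<q. z j + of_int v \<in> {x + of_int v + real j / real q..x + of_int v + real (Suc j) / real q}"
        using *(3) by (auto simp del: of_nat_Suc)
    qed (rule *(1))
  qed
  also have "\<dots> = real (card A) * (K * \<bar>\<tau>\<bar>)" by simp
  also have "\<dots> \<le> real (4 * R + 6) * (K * \<bar>\<tau>\<bar>)"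
    using A osc_diff_nonneg[OF f(1)] by (intro mult_right_mono) (simp_all only: of_nat_le_iff, simp)
  finally show "(\<Sum>j<q. \<bar>periodize f (y j + \<tau>) - periodize f (y j) - (periodize f (z j + \<tau>) - periodize f (z j))\<bar>)
    \<le> real (4 * R + 6) * K * \<bar>\<tau>\<bar>" by (simp add: mult.assoc)
qed

lemma continuous_on_periodize:
  assumes f: "continuous_on UNIV f" "\<And>x. \<bar>x\<bar> > real R \<Longrightarrow> f x = 0"
  shows "continuous_on UNIV (periodize f)"
proof -
  have "isCont (periodize f) x" for x
  proof -
    \<comment> \<open>Two neighbouring unit intervals surround \<open>x\<close>, so near
      \<open>x\<close> the periodization is one fixed finite sum.\<close>
    define A where "A = shifts R (x - 1) \<union> shifts R x"
    have cont: "continuous_on {x - 1<..<x + 1} (\<lambda>y. \<Sum>v\<in>A. f (y + of_int v))"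
      by (intro continuous_intros continuous_on_compose2[OF f(1)]) auto
    have eq: "periodize f y = (\<Sum>v\<in>A. f (y + of_int v))" if "y \<in> {x - 1<..<x + 1}" for y
    proof (rule periodize_eq)
      fix v assume "f (y + of_int v) \<noteq> 0"
      then show "v \<in> A"
        using in_shifts[of R f y v x, OF f(2)] in_shifts[of R f y v "x - 1", OF f(2)] that
        by (cases "x \<le> y") (auto simp: A_def)
    qed (simp add: A_def finite_shifts)
    have "continuous_on {x - 1<..<x + 1} (periodize f)"
      by (rule continuous_on_eq[OF cont]) (simp only: eq)
    then show ?thesis by (simp add: continuous_on_eq_continuous_at)
  qed
  then show ?thesis by (simp add: continuous_at_imp_continuous_on)
qed

lemma has_integral_unit_shifts:
  fixes f :: "real \<Rightarrow> real"
  assumes "continuous_on UNIV f"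
  shows "((\<lambda>x. \<Sum>k<n. f (x + c + real k)) has_integral integral {c..c + real n} f) {0..1}"
proof (induction n)
  case (Suc n)
  have f: "continuous_on S f" for S using assms continuous_on_subset by blast
  have "integral {0..1} (f \<circ> (\<lambda>x. x + (c + real n))) = integral {0 + (c + real n)..1 + (c + real n)} f"
    by (intro integral_shift f)
  moreover have "(f \<circ> (\<lambda>x. x + (c + real n))) integrable_on {0..1}"
    by (intro integrable_continuous_real continuous_on_compose f continuous_intros)
  ultimately have "((\<lambda>x. f (x + c + real n)) has_integral integral {c + real n..c + real (Suc n)} f) {0..1}"
    by (simp add: has_integral_iff o_def add_ac)
  from has_integral_add[OF Suc this] show ?case
    using Henstock_Kurzweil_Integration.integral_combine[of c "c + real n" "c + real (Suc n)" f]
      integrable_continuous_real[OF f] by (simp add: add_ac)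
qed simp

lemma has_integral_periodize:
  assumes f: "continuous_on UNIV f" "\<And>x. \<bar>x\<bar> > real R \<Longrightarrow> f x = 0"
    and I: "(f has_integral I) UNIV"
  shows "((\<lambda>x. periodize f (x + \<theta>)) has_integral I) {0..1}"
proof -
  \<comment> \<open>Large enough that, for \<open>x\<close> in the unit interval, every contributing
    shift is below \<open>N\<close> in absolute value and that the support of \<open>f\<close> lies
    within \<open>N\<close> of \<open>\<theta>\<close>.\<close>
  define N where "N = R + nat \<lceil>\<bar>\<theta>\<bar>\<rceil> + 2"
  have N: "real N \<ge> real R + \<bar>\<theta>\<bar> + 2" unfolding N_def by (simp; linarith)
  define c where "c = \<theta> - real N"
  have eq: "(\<Sum>k<2 * N. f (x + c + real k)) = periodize f (x + \<theta>)" if "x \<in> {0..1}" for x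
  proof -
    have "periodize f (x + \<theta>) = (\<Sum>v\<in>(\<lambda>k. int k - int N) ` {..<2 * N}. f (x + \<theta> + of_int v))"
    proof (rule periodize_eq)
      fix v assume "f (x + \<theta> + of_int v) \<noteq> 0"
      then have "\<bar>x + \<theta> + of_int v\<bar> \<le> real R" using f(2) by (meson not_le)
      then have "\<bar>real_of_int v\<bar> < real N" using N that by (auto simp: abs_if split: if_splits)
      then have "\<bar>v\<bar> < int N" by (metis of_int_abs of_int_less_iff of_int_of_nat_eq)
      then show "v \<in> (\<lambda>k. int k - int N) ` {..<2 * N}"
        by (intro image_eqI[of _ _ "nat (v + int N)"]) auto
    qed simp
    also have "\<dots> = (\<Sum>k<2 * N. f (x + c + real k))"
      by (subst sum.reindex) (auto simp: inj_on_def c_def algebra_simps)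
    finally show ?thesis by (rule sym)
  qed
  have "((\<lambda>x. \<Sum>k<2 * N. f (x + c + real k)) has_integral integral {c..c + real (2 * N)} f) {0..1}"
    by (rule has_integral_unit_shifts[OF f(1)])
  moreover have "integral {c..c + real (2 * N)} f = I"
  proof -
    have "f x = 0" if "x \<notin> {c..c + real (2 * N)}" for x
    proof -
      have "x < \<theta> - real N \<or> x > \<theta> + real N" using that by (auto simp: c_def)
      then show ?thesis using N by (intro f(2)) linarith
    qed
    then have "(\<lambda>x. if x \<in> {c..c + real (2 * N)} then f x else 0) = f" by auto
    then have "(f has_integral I) {c..c + real (2 * N)}"
      using has_integral_restrict_UNIV[of "{c..c + real (2 * N)}" f I] I by simp
    then show ?thesis by (rule integral_unique)
  qed
  ultimately have "((\<lambda>x. \<Sum>k<2 * N. f (x + c + real k)) has_integral I) {0..1}" by (simp only:)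
  then show ?thesis by (rule has_integral_eq[rotated]) (rule eq)
qed

section \<open>Cut-and-project sets and rotations\<close>

lemma card_int_near:
  fixes x c :: real
  assumes "c \<ge> 0"
  shows "finite {n :: int. \<bar>of_int n - x\<bar> \<le> c}" "real (card {n :: int. \<bar>of_int n - x\<bar> \<le> c}) \<le> 2 * c + 1"
proof -
  have eq: "{n :: int. \<bar>of_int n - x\<bar> \<le> c} = {\<lceil>x - c\<rceil>..\<lfloor>x + c\<rfloor>}"
    by (auto simp: abs_le_iff ceiling_le_iff le_floor_iff)
  show "finite {n :: int. \<bar>of_int n - x\<bar> \<le> c}" unfolding eq by simp
  have "real_of_int (\<lfloor>x + c\<rfloor> - \<lceil>x - c\<rceil> + 1) \<le> 2 * c + 1" by simp linarith
  then show "real (card {n :: int. \<bar>of_int n - x\<bar> \<le> c}) \<le> 2 * c + 1"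
    unfolding eq using assms by (cases "\<lfloor>x + c\<rfloor> - \<lceil>x - c\<rceil> + 1 \<ge> 0") simp_all
qed

text \<open>The range is read downwards from \<open>n\<close>, since the argument grows by
  \<open>\<alpha>\<close> when \<open>u\<close> drops by 1.\<close>

lemma sum_rotation_eq_birkhoff:
  fixes m n :: int
  assumes "m \<le> n + 1"
  shows "(\<Sum>u\<in>{m..n}. F (- (\<alpha> * of_int u))) = birkhoff F \<alpha> (nat (n - m + 1)) (- (\<alpha> * of_int n))"
proof -
  have "bij_betw (\<lambda>j. n - int j) {..<nat (n - m + 1)} {m..n}"
    by (rule bij_betw_byWitness[of _ "\<lambda>u. nat (n - u)"]) auto
  from sum.reindex_bij_betw[OF this, of "\<lambda>u. F (- (\<alpha> * of_int u))"] show ?thesis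
    by (simp add: birkhoff_def algebra_simps)
qed

definition lattice_point :: "int \<times> int \<Rightarrow> real^2" where
  "lattice_point p = vector [of_int (fst p), of_int (snd p)]"

text \<open>The second formula shows that a point of the strip has \<open>pi1\<close> equal to
  \<open>r\<close> times its first coordinate up to a bounded error.\<close>

lemma lattice_point_proj:
  fixes \<alpha> :: real
  defines "r \<equiv> sqrt (1 + \<alpha>\<^sup>2)"
  shows "pi2 \<alpha> (lattice_point p) = (of_int (snd p) - \<alpha> * of_int (fst p)) / r"
    and "pi1 \<alpha> (lattice_point p) = r * of_int (fst p) + \<alpha> * pi2 \<alpha> (lattice_point p)"
proof -
  have r: "r > 0" "r * r = 1 + \<alpha>\<^sup>2" by (simp_all add: r_def add_pos_nonneg)
  show 2: "pi2 \<alpha> (lattice_point p) = (of_int (snd p) - \<alpha> * of_int (fst p)) / r"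
    by (simp add: pi2_eq unit_H_def inner_vec_def sum_2 lattice_point_def r_def diff_divide_distrib)
  have "pi1 \<alpha> (lattice_point p) = (of_int (fst p) + \<alpha> * of_int (snd p)) / r"
    by (simp add: pi1_eq unit_G_def inner_vec_def sum_2 lattice_point_def r_def add_divide_distrib)
  also have "\<dots> = (of_int (fst p) * (1 + \<alpha>\<^sup>2) + \<alpha> * (of_int (snd p) - \<alpha> * of_int (fst p))) / r"
    by (simp add: power2_eq_square algebra_simps)
  also have "\<dots> = r * of_int (fst p) + \<alpha> * pi2 \<alpha> (lattice_point p)"
    unfolding 2 r(2)[symmetric] using r(1) by (simp add: field_simps)
  finally show "pi1 \<alpha> (lattice_point p) = r * of_int (fst p) + \<alpha> * pi2 \<alpha> (lattice_point p)" .
qed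

lemma range_lattice_point: "range lattice_point = Gamma"
proof
  show "range lattice_point \<subseteq> Gamma"
    by (auto simp: Gamma_def lattice_point_def forall_2)
  show "Gamma \<subseteq> range lattice_point"
  proof
    fix x :: "real^2" assume "x \<in> Gamma"
    then obtain u v where "x $ 1 = of_int u" "x $ 2 = of_int v"
      unfolding Gamma_def by (metis Ints_cases mem_Collect_eq)
    then have "x = lattice_point (u, v)" by (simp add: lattice_point_def vec_eq_iff forall_2)
    then show "x \<in> range lattice_point" by blast
  qed
qed

lemma inj_lattice_point: "inj lattice_point"
  by (rule injI) (auto simp: lattice_point_def vec_eq_iff forall_2 prod_eq_iff)

lemma weighted_dirac_comb_lattice:
  fixes \<alpha> a b s t :: real
  assumes "\<alpha> \<notin> \<rat>"
  defines "P \<equiv> {p. pi1 \<alpha> (lattice_point p) \<in> {s..t} \<and> pi2 \<alpha> (lattice_point p) \<in> {a..b}}"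
  shows "finite P"
    and "weighted_dirac_comb (cut_and_project \<alpha> {a..b}) (\<lambda>x. h (star_map \<alpha> x)) {s..t} =
      (\<Sum>p\<in>P. h (pi2 \<alpha> (lattice_point p)))"
proof -
  let ?\<phi> = "\<lambda>p. pi1 \<alpha> (lattice_point p)"
  have "inj_on (pi1 \<alpha>) (range lattice_point)" using inj_on_pi1[OF assms(1)] range_lattice_point by simp
  then have inj: "inj ?\<phi>" using comp_inj_on[OF inj_lattice_point] by (simp add: o_def)
  have img: "?\<phi> ` P = cut_and_project \<alpha> {a..b} \<inter> {s..t}"
    unfolding cut_and_project_def P_def range_lattice_point[symmetric] by auto
  then have "finite (?\<phi> ` P)" using finite_cut_and_project by simp
  then show "finite P" using inj finite_imageD inj_on_subset by blast
  have "lattice_point p \<in> Gamma" for p using range_lattice_point by blast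
  then have star: "star_map \<alpha> (?\<phi> p) = pi2 \<alpha> (lattice_point p)" for p
    using the_inv_into_f_f[OF inj_on_pi1[OF assms(1)]] by (simp add: star_map_def)
  show "weighted_dirac_comb (cut_and_project \<alpha> {a..b}) (\<lambda>x. h (star_map \<alpha> x)) {s..t} =
      (\<Sum>p\<in>P. h (pi2 \<alpha> (lattice_point p)))"
    unfolding weighted_dirac_comb_Icc img[symmetric]
    by (subst sum.reindex) (auto intro: inj_on_subset[OF inj] simp: star)
qed

lemma has_integral_rescale:
  fixes h :: "real \<Rightarrow> real"
  assumes "continuous_on UNIV h" "\<And>x. x \<notin> {a..b} \<Longrightarrow> h x = 0" "r > 0" "a < b"
  shows "((\<lambda>x. h (x / r)) has_integral r * integral {a..b} h) UNIV"
proof -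
  have "(h has_integral integral {a..b} h) (cbox a b)"
    using integrable_continuous_real[of a b h] assms(1) continuous_on_subset integrable_integral by force
  then have "((\<lambda>x. h (1 / r * x)) has_integral (1 / \<bar>1 / r\<bar>) *\<^sub>R integral {a..b} h) ((\<lambda>x. x / (1 / r)) ` {a..b})"
    using \<open>r > 0\<close> by (intro has_integral_stretch_real) auto
  then have "((\<lambda>x. h (x / r)) has_integral r * integral {a..b} h) ((\<lambda>x. x * r) ` {a..b})"
    using \<open>r > 0\<close> by simp
  then show ?thesis
  proof (rule has_integral_on_superset)
    fix x assume "x \<notin> (\<lambda>x. x * r) ` {a..b}"
    then have "x / r \<notin> {a..b}" using \<open>r > 0\<close> by (metis image_eqI nonzero_eq_divide_eq less_irrefl)
    then show "h (x / r) = 0" by (rule assms)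
  qed simp
qed

lemma bounded_distance_equivalent_comb:
  fixes \<alpha> a b B K C :: real and h :: "real \<Rightarrow> real"
  assumes irr: "\<alpha> \<notin> \<rat>" and "a < b"
    and h: "continuous_on UNIV h" "\<And>x. x \<notin> {a..b} \<Longrightarrow> h x = 0"
  defines "r \<equiv> sqrt (1 + \<alpha>\<^sup>2)" and "I \<equiv> integral {a..b} h"
  defines "F \<equiv> periodize (\<lambda>x. h (x / r))"
  assumes B: "\<And>N x. \<bar>birkhoff F \<alpha> N x - real N * (r * I)\<bar> \<le> B"
  shows "bounded_distance_equivalent
           (weighted_dirac_comb (cut_and_project \<alpha> {a..b}) (\<lambda>x. h (star_map \<alpha> x)))
           (scaled_lebesgue I)"
proof -
  have r: "r > 0" by (simp add: r_def add_pos_nonneg)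
  \<comment> \<open>\<open>D\<close> bounds \<open>pi2\<close> on the window, and \<open>c\<close>
    bounds the distance of \<open>pi1 / r\<close> from the first coordinate.\<close>
  define D where "D = \<bar>a\<bar> + \<bar>b\<bar>"
  define c where "c = \<bar>\<alpha>\<bar> * D / r"
  have "D \<ge> 0" by (simp add: D_def)
  then have c: "c \<ge> 0" using r by (simp add: c_def)
  have "compact (h ` {a..b})" using h(1) by (intro compact_continuous_image) (auto intro: continuous_on_subset)
  then obtain H where "\<forall>y\<in>h ` {a..b}. norm y \<le> H" using compact_imp_bounded bounded_iff by metis
  then have H': "\<bar>h x\<bar> \<le> H" if "x \<in> {a..b}" for x using that by auto
  then have "H \<ge> 0" using \<open>a < b\<close> abs_ge_zero[of "h a"] by (meson atLeastAtMost_iff less_imp_le order_refl order_trans)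
  with H' h(2) have H: "\<bar>h x\<bar> \<le> H" for x by (cases "x \<in> {a..b}") auto
  let ?lp = lattice_point
  define w where "w p = h (pi2 \<alpha> (?lp p))" for p
  note pr = lattice_point_proj[of \<alpha>, folded r_def]
  \<comment> \<open>At most \<open>2 * (2 * c + 1)\<close> columns lie within \<open>c\<close> of an
    end of the interval, each with at most \<open>2 * (r * D) + 1\<close> points of the
    strip.\<close>
  define L where "L = 2 * (2 * c + 1) * (2 * (r * D) + 1)"
  have main: "\<bar>weighted_dirac_comb (cut_and_project \<alpha> {a..b}) (\<lambda>x. h (star_map \<alpha> x)) {s..t} - scaled_lebesgue I {s..t}\<bar>
      \<le> 2 * L * H + B + \<bar>r * I\<bar>" if st: "s < t" for s t
  proof -
    define T T' where "T = s / r" and "T' = t / r"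
    have TT: "T < T'" using st r by (simp add: T_def T'_def divide_strict_right_mono)
    define P where "P = {p. pi1 \<alpha> (?lp p) \<in> {s..t} \<and> pi2 \<alpha> (?lp p) \<in> {a..b}}"
    define m n where "m = \<lceil>T\<rceil>" and "n = \<lfloor>T'\<rfloor>"
    define V where "V u = {v :: int. (of_int v - \<alpha> * of_int u) / r \<in> {a..b}}" for u :: int
    \<comment> \<open>\<open>Q\<close> imposes on the first coordinate, scaled by \<open>r\<close>,
      what \<open>P\<close> imposes on \<open>pi1\<close>; it thereby consists of full
      columns.\<close>
    define Q where "Q = Sigma {m..n} V"
    define X where "X = ({u :: int. \<bar>of_int u - T\<bar> \<le> c} \<union> {u. \<bar>of_int u - T'\<bar> \<le> c})"
    define Y where "Y u = {v :: int. \<bar>of_int v - \<alpha> * of_int u\<bar> \<le> r * D}" for u :: int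
    have rD: "r * D \<ge> 0" using r \<open>D \<ge> 0\<close> by simp
    have Y: "finite (Y u)" "real (card (Y u)) \<le> 2 * (r * D) + 1" for u
      unfolding Y_def using card_int_near[OF rD] by blast+
    have X: "finite X" unfolding X_def using card_int_near(1)[OF c] by blast
    have "real (card X) \<le> real (card {u :: int. \<bar>of_int u - T\<bar> \<le> c}) + real (card {u :: int. \<bar>of_int u - T'\<bar> \<le> c})"
      unfolding X_def of_nat_add[symmetric] of_nat_le_iff by (rule card_Un_le)
    also have "\<dots> \<le> (2 * c + 1) + (2 * c + 1)"
      by (intro add_mono card_int_near(2) c)
    finally have cX: "real (card X) \<le> 2 * (2 * c + 1)" by simp
    have "real (card (Sigma X Y)) = (\<Sum>u\<in>X. real (card (Y u)))"
      using X Y(1) by (simp add: card_SigmaI)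
    also have "\<dots> \<le> real (card X) * (2 * (r * D) + 1)"
      using Y(2) by (intro sum_bounded_above) simp
    also have "\<dots> \<le> L" unfolding L_def using cX rD by (intro mult_right_mono) auto
    finally have cXY: "real (card (Sigma X Y)) \<le> L" .
    have fXY: "finite (Sigma X Y)" using X Y(1) by (rule finite_SigmaI)
    have VY: "V u \<subseteq> Y u" for u
    proof
      fix v assume "v \<in> V u"
      then have "\<bar>(of_int v - \<alpha> * of_int u) / r\<bar> \<le> D" by (auto simp: V_def D_def)
      then show "v \<in> Y u" using r by (simp add: Y_def field_simps)
    qed
    have V: "finite (V u)" for u using VY Y(1) finite_subset by blast
    have V_iff: "snd p \<in> V (fst p) \<longleftrightarrow> pi2 \<alpha> (?lp p) \<in> {a..b}" for p
      unfolding V_def pr(1) by simp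
    have near: "\<bar>pi1 \<alpha> (?lp p) / r - of_int (fst p)\<bar> \<le> c" if "pi2 \<alpha> (?lp p) \<in> {a..b}" for p
    proof -
      have "\<bar>pi2 \<alpha> (?lp p)\<bar> \<le> D" using that by (auto simp: D_def)
      then have "\<bar>\<alpha>\<bar> * \<bar>pi2 \<alpha> (?lp p)\<bar> / r \<le> c" unfolding c_def using r
        by (intro divide_right_mono mult_left_mono) auto
      moreover have "pi1 \<alpha> (?lp p) / r - of_int (fst p) = \<alpha> * pi2 \<alpha> (?lp p) / r"
        using pr(2)[of p] r by (simp add: field_simps)
      ultimately show ?thesis using r by (simp add: abs_mult)
    qed
    have P_iff: "p \<in> P \<longleftrightarrow> T \<le> pi1 \<alpha> (?lp p) / r \<and> pi1 \<alpha> (?lp p) / r \<le> T' \<and> pi2 \<alpha> (?lp p) \<in> {a..b}" for p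
      using r unfolding P_def T_def T'_def by (simp add: divide_le_cancel)
    have Q_iff: "p \<in> Q \<longleftrightarrow> T \<le> of_int (fst p) \<and> of_int (fst p) \<le> T' \<and> pi2 \<alpha> (?lp p) \<in> {a..b}" for p
      using V_iff[of p] by (cases p) (auto simp: Q_def m_def n_def ceiling_le_iff le_floor_iff)
    \<comment> \<open>For a point in just one of the sets, \<open>T\<close> or \<open>T'\<close>
      separates \<open>pi1 / r\<close> from the first coordinate, hence is within \<open>c\<close>
      of the latter.\<close>
    have sub: "(P - Q) \<union> (Q - P) \<subseteq> Sigma X Y"
    proof
      fix p assume p: "p \<in> (P - Q) \<union> (Q - P)"
      then have pi2: "pi2 \<alpha> (?lp p) \<in> {a..b}" by (auto simp: P_iff Q_iff)
      then have "snd p \<in> Y (fst p)" using V_iff VY by blast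
      moreover have "\<bar>of_int (fst p) - T\<bar> \<le> c \<or> \<bar>of_int (fst p) - T'\<bar> \<le> c"
        using p near[OF pi2] pi2 TT unfolding Un_iff Diff_iff P_iff Q_iff by linarith
      ultimately show "p \<in> Sigma X Y" by (cases p) (auto simp: X_def)
    qed
    have fP: "finite P" unfolding P_def by (rule weighted_dirac_comb_lattice[OF irr])
    have fQ: "finite Q" unfolding Q_def using V by (intro finite_SigmaI) auto
    have small: "\<bar>sum w Z\<bar> \<le> L * H" if "Z \<subseteq> Sigma X Y" for Z
    proof -
      have "\<bar>sum w Z\<bar> \<le> (\<Sum>p\<in>Z. \<bar>w p\<bar>)" by (rule sum_abs)
      also have "\<dots> \<le> real (card Z) * H" using H by (intro sum_bounded_above) (simp add: w_def)
      also have "\<dots> \<le> L * H"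
        using cXY card_mono[OF fXY that] \<open>H \<ge> 0\<close> by (intro mult_right_mono) linarith+
      finally show ?thesis .
    qed
    have "sum w P - sum w Q = sum w (P - Q) - sum w (Q - P)"
      using sum.Int_Diff[OF fP, of w Q] sum.Int_Diff[OF fQ, of w P] by (simp add: Int_commute)
    then have PQ: "\<bar>sum w P - sum w Q\<bar> \<le> 2 * L * H"
      using small[of "P - Q"] small[of "Q - P"] sub by auto
    have "sum w Q = (\<Sum>u\<in>{m..n}. \<Sum>v\<in>V u. w (u, v))"
      unfolding Q_def using V by (subst sum.Sigma) auto
    \<comment> \<open>As \<open>h\<close> vanishes off the window, each column sum is a value of the
      periodization.\<close>
    also have "\<dots> = (\<Sum>u\<in>{m..n}. F (- (\<alpha> * of_int u)))"
    proof (rule sum.cong)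
      fix u assume "u \<in> {m..n}"
      have "F (- (\<alpha> * of_int u)) = (\<Sum>v\<in>V u. h ((- (\<alpha> * of_int u) + of_int v) / r))"
        unfolding F_def using h(2) by (intro periodize_eq V) (force simp: V_def)
      then show "(\<Sum>v\<in>V u. w (u, v)) = F (- (\<alpha> * of_int u))" by (simp add: w_def pr(1))
    qed simp
    also have "\<dots> = birkhoff F \<alpha> (nat (n - m + 1)) (- (\<alpha> * of_int n))"
      using TT by (intro sum_rotation_eq_birkhoff) (simp add: m_def n_def; linarith)
    finally have Q: "\<bar>sum w Q - real (nat (n - m + 1)) * (r * I)\<bar> \<le> B" using B by simp
    \<comment> \<open>The number of integers in an interval differs from its length by at most
      1.\<close>
    have "\<bar>real (nat (n - m + 1)) - (T' - T)\<bar> \<le> 1" using TT unfolding m_def n_def by linarith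
    then have "\<bar>real (nat (n - m + 1)) - (T' - T)\<bar> * \<bar>r * I\<bar> \<le> 1 * \<bar>r * I\<bar>" by (rule mult_right_mono) simp
    then have "\<bar>real (nat (n - m + 1)) * (r * I) - (T' - T) * (r * I)\<bar> \<le> \<bar>r * I\<bar>"
      by (simp only: abs_mult[symmetric] left_diff_distrib mult_1)
    moreover have "(T' - T) * (r * I) = scaled_lebesgue I {s..t}"
      using r st by (simp add: T_def T'_def scaled_lebesgue_def field_simps)
    moreover have "weighted_dirac_comb (cut_and_project \<alpha> {a..b}) (\<lambda>x. h (star_map \<alpha> x)) {s..t} = sum w P"
      unfolding w_def P_def by (rule weighted_dirac_comb_lattice[OF irr])
    ultimately show ?thesis using PQ Q by linarith
  qed
  show ?thesis unfolding bounded_distance_equivalent_def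
    by (rule exI[of _ "\<bar>2 * L * H + B + \<bar>r * I\<bar>\<bar> + 1"]) (use main in fastforce)
qed

theorem theorem4p1:
  fixes \<alpha> C a b :: real and pq :: "nat \<Rightarrow> int" and h :: "real \<Rightarrow> real"
  assumes "\<alpha> \<notin> \<rat>"
    and "has_cf_expansion \<alpha> pq"
    and "\<And>m' :: nat. (\<Sum>l=0..m'. real_of_int (pq (l + 1)) / sqrt (real_of_int (cf_denom pq l))
           * (\<Sum>k=1..l + 1. real_of_int (pq k))) < C"
    and "a < b"
    and "continuous_on UNIV h"
    and "\<And>x. x \<notin> {a..b} \<Longrightarrow> h x = 0"
    and "\<And>x. x \<in> interior {a..b} \<Longrightarrow> h x \<noteq> 0"
    and "piecewise_linear h \<or> bounded_second_derivative_on h {a..b}"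
  shows "bounded_distance_equivalent
           (weighted_dirac_comb (cut_and_project \<alpha> {a..b}) (\<lambda>x. h (star_map \<alpha> x)))
           (scaled_lebesgue (integral {a..b} h))"
proof -
  define r where "r = sqrt (1 + \<alpha>\<^sup>2)"
  have r: "r > 0" by (simp add: r_def add_pos_nonneg)
  define f where "f x = h (x / r)" for x
  \<comment> \<open>Any \<open>x\<close> with \<open>x / r\<close> in the window is bounded by
    \<open>r * (\<bar>a\<bar> + \<bar>b\<bar>)\<close>.\<close>
  define R where "R = nat \<lceil>r * (\<bar>a\<bar> + \<bar>b\<bar>)\<rceil>"
  have "scalable_osc_diff h"
    using assms(8) scalable_osc_diff_piecewise_linear[OF _ assms(5)]
      scalable_osc_diff_second_derivative[OF assms(5,6,4)] by blast
  then obtain K where K: "osc_diff K f"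
    using r unfolding scalable_osc_diff_def f_def by blast
  have cont: "continuous_on UNIV f"
    unfolding f_def using r by (intro continuous_on_compose2[OF assms(5)] continuous_intros) auto
  have supp: "f x = 0" if "\<bar>x\<bar> > real R" for x
    unfolding f_def
  proof (rule assms(6), rule notI)
    assume "x / r \<in> {a..b}"
    then have "\<bar>x / r\<bar> \<le> \<bar>a\<bar> + \<bar>b\<bar>" by auto
    then have "\<bar>x\<bar> \<le> r * (\<bar>a\<bar> + \<bar>b\<bar>)" using r by (simp add: field_simps)
    then show False using that unfolding R_def by linarith
  qed
  have int: "(f has_integral r * integral {a..b} h) UNIV"
    unfolding f_def by (rule has_integral_rescale[OF assms(5,6) r assms(4)])
  have bound: "\<bar>birkhoff (periodize f) \<alpha> N x - real N * (r * integral {a..b} h)\<bar> \<le> 6 * (real (4 * R + 6) * K) * C" for N x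
    by (rule birkhoff_bounded[OF osc_diff_periodize[OF K supp] continuous_on_periodize[OF cont supp]
          periodize_periodic has_integral_periodize[OF cont supp int] assms(2,3)])
  show ?thesis
    by (rule bounded_distance_equivalent_comb[OF assms(1,4,5,6)]) (use bound in \<open>simp_all add: f_def[abs_def] r_def\<close>)
qed

end
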